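(* Let $L:A\to\mathbb R$ be a linear functional with $L(1)=1$. Then there exists a unique representing measure $\nu_L$ for $L$ with compact support if and only if $$C_a=\sup_{n\in\mathbb N}\sqrt[2n]{L(a^{2n})}<\infty\quad\text{for all }a\in A$$ and $$L(C_{j_1,a_1}\cdots C_{j_n,a_n})\ge 0\quad\text{for all } n\in\mathbb N,\ a_1,\dots,a_n\in A,\ j_1,\dots,j_n\in\{1,2\},$$ where $C_{1,a}=C_a-a$ and $C_{2,a}=C_a+a$. Moreover, if there is a family of positive numbers $(T_a)_{a\in A}$ such that $$L(T_{j_1,a_1}\cdots T_{j_n,a_n})\ge 0\quad\text{for all } n\in\mathbb N,\ a_1,\dots,a_n\in A,\ j_1,\dots,j_n\in\{1,2\},$$ where $T_{1,a}=T_a-a$ and $T_{2,a}=T_a+a$, then $L$ is positive semidefinite, $C_a=\sup_{n\in\mathbb N}\sqrt[2n]{L(a^{2n})}<\infty$ for all $a\in A$, and $C_a\le T_a$ for all $a\in A$.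
   Context: $A$ is a unital commutative $\mathbb R$-algebra and $X(A)$ is the set of all (unital) $\mathbb R$-algebra homomorphisms $A\to\mathbb R$, assumed non-empty and endowed with the topology of pointwise convergence. $\mathbb N=\{1,2,\dots\}$. Real numbers are regarded as elements of $A$ via $\lambda\mapsto\lambda\cdot 1$. A linear functional $L:A\to\mathbb R$ is positive semidefinite if $L(a^2)\ge 0$ for all $a\in A$. A representing measure for $L$ is a positive Radon measure $\mu$ on $X(A)$ such that $L(a)=\int\alpha(a)\,d\mu(\alpha)$ for all $a\in A$. The condition $C_a<\infty$ is understood to include that the real roots are defined, i.e. that $L(a^{2n})\ge 0$ for all $n\in\mathbb N$. *)

theory Defs
  imports "HOL-Analysis.Analysis"
begin

definition characters :: "('a::{real_algebra_1,comm_ring_1} \<Rightarrow> real) set" where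
  "characters = {\<alpha>. linear \<alpha> \<and> (\<forall>a b. \<alpha> (a * b) = \<alpha> a * \<alpha> b) \<and> \<alpha> 1 = 1}"

(* The topology of pointwise convergence, i.e. the trace of the product topology. *)
definition char_space :: "('a::{real_algebra_1,comm_ring_1} \<Rightarrow> real) topology" where
  "char_space = subtopology (powertop_real UNIV) characters"

(* Radon measure on a Hausdorff space: a Borel measure that is locally finite and inner regular
   with respect to compact sets. *)
definition radon_measure_on :: "'b topology \<Rightarrow> 'b measure \<Rightarrow> bool" where
  "radon_measure_on X \<mu> \<longleftrightarrow>
     space \<mu> = topspace X \<and>
     sets \<mu> = sigma_sets (topspace X) {U. openin X U} \<and>
     (\<forall>x\<in>topspace X. \<exists>U. openin X U \<and> x \<in> U \<and> emeasure \<mu> U < \<infinity>) \<and>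
     (\<forall>B\<in>sets \<mu>. emeasure \<mu> B = (SUP K\<in>{K. compactin X K \<and> K \<subseteq> B}. emeasure \<mu> K))"

definition measure_support :: "'b topology \<Rightarrow> 'b measure \<Rightarrow> 'b set" where
  "measure_support X \<mu> =
     {x \<in> topspace X. \<forall>U. openin X U \<longrightarrow> x \<in> U \<longrightarrow> emeasure \<mu> U > 0}"

(* Integrability is explicit because the Bochner integral of a non-integrable function is 0. *)
definition representing_measure ::
    "('a::{real_algebra_1,comm_ring_1} \<Rightarrow> real) \<Rightarrow> ('a \<Rightarrow> real) measure \<Rightarrow> bool" where
  "representing_measure L \<mu> \<longleftrightarrow>
     radon_measure_on char_space \<mu> \<and>
     (\<forall>a. integrable \<mu> (\<lambda>\<alpha>. \<alpha> a) \<and> L a = (\<integral>\<alpha>. \<alpha> a \<partial>\<mu>))"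

definition positive_semidefinite :: "('a::{real_algebra_1,comm_ring_1} \<Rightarrow> real) \<Rightarrow> bool" where
  "positive_semidefinite L \<longleftrightarrow> (\<forall>a. L (a^2) \<ge> 0)"

definition C_bound :: "('a::{real_algebra_1,comm_ring_1} \<Rightarrow> real) \<Rightarrow> 'a \<Rightarrow> ereal" where
  "C_bound L a = (SUP n\<in>{1::nat..}. ereal (root (2 * n) (L (a ^ (2 * n)))))"

(* The nonnegativity clause says that the real roots are defined; it is needed because
   the library function root is the odd extension to negative arguments. *)
definition C_finite :: "('a::{real_algebra_1,comm_ring_1} \<Rightarrow> real) \<Rightarrow> 'a \<Rightarrow> bool" where
  "C_finite L a \<longleftrightarrow> (\<forall>n\<ge>1. L (a ^ (2 * n)) \<ge> 0) \<and> C_bound L a < \<infinity>"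

(* For j = 1, 2 this is the element c_a - a, respectively c_a + a. *)
definition signed_factor ::
    "('a::{real_algebra_1,comm_ring_1} \<Rightarrow> real) \<Rightarrow> nat \<Rightarrow> 'a \<Rightarrow> 'a" where
  "signed_factor c j a = (if j = 1 then of_real (c a) - a else of_real (c a) + a)"

definition nonneg_on_products ::
    "('a::{real_algebra_1,comm_ring_1} \<Rightarrow> real) \<Rightarrow> ('a \<Rightarrow> real) \<Rightarrow> bool" where
  "nonneg_on_products L c \<longleftrightarrow>
     (\<forall>n\<ge>1. \<forall>(a::nat \<Rightarrow> 'a) (j::nat \<Rightarrow> nat). (\<forall>i\<in>{1..n}. j i \<in> {1, 2}) \<longrightarrow>
        L (\<Prod>i=1..n. signed_factor c (j i) (a i)) \<ge> 0)"

end

theory Submission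
  imports Defs "HOL-Probability.Discrete_Topology" "HOL-Probability.Probability_Measure"
begin

text \<open>
  Write \<open>K\<close> for the set of characters \<open>\<alpha>\<close> with \<open>\<bar>\<alpha> a\<bar> \<le> C\<^sub>a\<close> for all \<open>a\<close>. It is compact, being a
  closed subset of a product of compact intervals, and it is the place where the representing
  measure has to live.

  For existence, let \<open>P\<close> be the set of all sums of products of the elements \<open>C\<^sub>a - a\<close>, \<open>C\<^sub>a + a\<close> with
  nonnegative real coefficients. It is closed under sums and products, and every element of the
  algebra is bounded by a constant modulo \<open>P\<close>. The Archimedean Positivstellensatz
  (\<open>positive_on_characters_imp_mem\<close>) says that an element that is strictly positive at all
  characters nonnegative on \<open>P\<close> belongs to \<open>P\<close>. Those characters lie in \<open>K\<close>, and \<open>L\<close> is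
  nonnegative on \<open>P\<close>, so that \<open>L f \<ge> 0\<close> whenever \<open>f\<close> is nonnegative on \<open>K\<close>
  (\<open>nonneg_on_box_imp_nonneg\<close>). By the Hahn-Banach theorem \<open>L\<close> then extends to a positive functional
  \<open>\<Phi>\<close> on \<^emph>\<open>all\<close> bounded functions on \<open>K\<close> (\<open>positive_functional_extension\<close>). Admitting discontinuous
  functions pays off: \<open>E \<mapsto> \<Phi> 1\<^sub>E\<close> is a finitely additive set function, and its regularisation, first
  from inside by compact sets and then from outside by open sets, is a Radon measure that
  integrates every continuous function to its value under \<open>\<Phi>\<close>
  (\<open>radon_measure_of_positive_functional\<close>).

  Uniqueness is the Stone-Weierstrass theorem on the union of the two compact supports: the
  evaluations \<open>\<alpha> \<mapsto> \<alpha> a\<close> form a point-separating algebra, hence separate disjoint compact sets up to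
  \<open>\<epsilon>\<close>, and a Radon measure is determined by its values on compact sets.

  Conversely, let \<open>\<nu>\<close> be a representing measure with compact support. If \<open>\<bar>\<alpha> a\<bar> > t > C\<^sub>a\<close> at some point
  of the support, then the open set where this holds has positive mass \<open>m\<close>, and
  \<open>t\<^bsup>2n\<^esup> m \<le> L (a\<^bsup>2n\<^esup>) \<le> C\<^sub>a\<^bsup>2n\<^esup>\<close> for all \<open>n\<close>, which is absurd. So \<open>C\<^sub>a - a\<close> and \<open>C\<^sub>a + a\<close> are nonnegative
  on the support, and so are their products.

  The statement about a family \<open>T\<close> follows from the same positivity result with \<open>T\<close> in place of \<open>C\<close>:
  the elements \<open>a\<^sup>2\<close> and \<open>T\<^sub>a\<^bsup>2n\<^esup> - a\<^bsup>2n\<^esup>\<close> are nonnegative at all characters bounded by \<open>T\<close>.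
\<close>

section \<open>Archimedean preprimes and characters\<close>

text \<open>
  The last axiom makes every element bounded by a constant with respect to the preorder that \<open>P\<close>
  defines. This is what makes real-valued characters appear.
\<close>

locale archimedean_preprime =
  fixes P :: "'a::{real_algebra_1,comm_ring_1} set"
  assumes add: "x \<in> P \<Longrightarrow> y \<in> P \<Longrightarrow> x + y \<in> P"
    and mult: "x \<in> P \<Longrightarrow> y \<in> P \<Longrightarrow> x * y \<in> P"
    and const: "0 \<le> r \<Longrightarrow> of_real r \<in> P"
    and arch: "\<exists>N\<ge>0. of_real N - x \<in> P"
begin

definition proper_module :: "'a set \<Rightarrow> bool" where
  "proper_module Q \<longleftrightarrow> P \<subseteq> Q \<and> (\<forall>x\<in>Q. \<forall>y\<in>Q. x + y \<in> Q) \<and> (\<forall>p\<in>P. \<forall>x\<in>Q. p * x \<in> Q) \<and> - 1 \<notin> Q"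

lemma arch_plus: "\<exists>N\<ge>0. x + of_real N \<in> P"
  using arch[of "- x"] by (simp add: add.commute)

context
  fixes Q :: "'a set"
  assumes proper: "proper_module Q"
begin

lemma P_subset: "p \<in> P \<Longrightarrow> p \<in> Q"
  and Q_add: "x \<in> Q \<Longrightarrow> y \<in> Q \<Longrightarrow> x + y \<in> Q"
  and Q_mult: "p \<in> P \<Longrightarrow> x \<in> Q \<Longrightarrow> p * x \<in> Q"
  and minus_one: "- 1 \<notin> Q"
  using proper by (auto simp: proper_module_def)

text \<open>
  A negative constant could be rescaled to \<open>- 1\<close>, so inside a proper module the reals keep their order.
\<close>

lemma of_real_mem_iff: "of_real r \<in> Q \<longleftrightarrow> 0 \<le> r"
proof
  assume r: "of_real r \<in> Q"
  show "0 \<le> r"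
  proof (rule ccontr)
    assume "\<not> 0 \<le> r"
    then have "of_real (- (1 / r)) * (of_real r :: 'a) \<in> Q"
      using Q_mult[OF const r, of "- (1 / r)"] by simp
    moreover have "of_real (- (1 / r)) * (of_real r :: 'a) = - 1"
      using \<open>\<not> 0 \<le> r\<close> by (simp flip: of_real_mult)
    ultimately show False
      using minus_one by simp
  qed
qed (use P_subset const in auto)

text \<open>
  The number \<open>c\<close> is the value of \<open>f\<close> in the real ordered quotient described by \<open>Q\<close>. The slack \<open>e\<close> replaces
  a closedness assumption on \<open>Q\<close>: infinitesimal elements get the value \<open>0\<close>.
\<close>

definition approx :: "'a \<Rightarrow> real \<Rightarrow> bool" where
  "approx f c \<longleftrightarrow> (\<forall>e>0. of_real (c + e) - f \<in> Q \<and> f - of_real (c - e) \<in> Q)"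

lemma approx_le:
  assumes "approx f c" "approx f d"
  shows "c \<le> d"
proof (rule field_le_epsilon)
  fix e :: real assume "e > 0"
  then have "of_real (d + e/2) - f \<in> Q" "f - of_real (c - e/2) \<in> Q"
    using assms unfolding approx_def by (meson half_gt_zero)+
  from Q_add[OF this] have "of_real (d + e/2 - (c - e/2)) \<in> Q"
    by (simp only: of_real_diff[of "d + e/2" "c - e/2"] add_diff_eq diff_add_cancel)
  then show "c \<le> d + e"
    unfolding of_real_mem_iff by simp
qed

lemma approx_unique: "approx f c \<Longrightarrow> approx f d \<Longrightarrow> c = d"
  by (simp add: approx_le antisym)

lemma approx_shift: "approx (f - of_real d) (c - d) \<longleftrightarrow> approx f c"
  by (simp add: approx_def algebra_simps)

lemma approx_shift_0: "approx (f - of_real c) 0 \<longleftrightarrow> approx f c"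
  using approx_shift[of f c c] by simp

lemma approx_add:
  assumes "approx f c" "approx g d"
  shows "approx (f + g) (c + d)"
  unfolding approx_def
proof (intro allI impI)
  fix e :: real assume "e > 0"
  then have e: "of_real (c + e/2) - f \<in> Q" "f - of_real (c - e/2) \<in> Q"
     "of_real (d + e/2) - g \<in> Q" "g - of_real (d - e/2) \<in> Q"
    using assms unfolding approx_def by (meson half_gt_zero)+
  have "(of_real (c + e/2) - f) + (of_real (d + e/2) - g) = of_real ((c + e/2) + (d + e/2)) - (f + g)"
    "(f - of_real (c - e/2)) + (g - of_real (d - e/2)) = f + g - of_real ((c - e/2) + (d - e/2))"
    by (simp_all only: of_real_add of_real_diff) (simp_all add: algebra_simps)
  moreover have "(c + e/2) + (d + e/2) = c + d + e" "(c - e/2) + (d - e/2) = c + d - e"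
    by simp_all
  ultimately show "of_real (c + d + e) - (f + g) \<in> Q \<and> f + g - of_real (c + d - e) \<in> Q"
    using Q_add[OF e(1,3)] Q_add[OF e(2,4)] by metis
qed

lemma approx_uminus: "approx f c \<Longrightarrow> approx (- f) (- c)"
  by (simp add: approx_def algebra_simps)

text \<open>
  Multiplying \<open>- e / M \<le> f \<le> e / M\<close> by \<open>p\<close> and using \<open>p \<le> M\<close> gives \<open>- e \<le> f p \<le> e\<close>.
\<close>

lemma approx_0_mult_P:
  assumes f: "approx f 0" and p: "p \<in> P"
  shows "approx (f * p) 0"
  unfolding approx_def
proof (intro allI impI)
  fix e :: real assume e: "e > 0"
  obtain N where N: "N \<ge> 0" "of_real N - p \<in> P"
    using arch by blast
  define M where "M = N + 1"
  have M: "M > 0" "of_real M - p \<in> P"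
    using N add[OF N(2) const[of 1]] by (auto simp: M_def algebra_simps)
  have "e / M > 0"
    using M e by simp
  then have *: "of_real (e/M) - f \<in> Q" "f + of_real (e/M) \<in> Q"
    using f by (auto simp: approx_def)
  have r: "of_real (e/M) * (of_real M - p) \<in> Q"
    using mult[OF const M(2)] \<open>e / M > 0\<close> P_subset by auto
  have eM: "of_real (e/M) * of_real M = (of_real e :: 'a)"
    using M by (simp flip: of_real_mult)
  have "p * (of_real (e/M) - f) + of_real (e/M) * (of_real M - p) = of_real e - f * p"
    "p * (f + of_real (e/M)) + of_real (e/M) * (of_real M - p) = of_real e + f * p"
    by (simp_all only: right_diff_distrib eM) (simp_all add: algebra_simps)
  with Q_add[OF Q_mult[OF p *(1)] r] Q_add[OF Q_mult[OF p *(2)] r]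
  show "of_real (0 + e) - f * p \<in> Q \<and> f * p - of_real (0 - e) \<in> Q"
    by (simp add: algebra_simps)
qed

text \<open>
  Every element is a difference of two members of \<open>P\<close>, so infinitesimal elements form an ideal.
\<close>

lemma approx_0_mult:
  assumes f: "approx f 0"
  shows "approx (f * x) 0"
proof -
  obtain N where N: "N \<ge> 0" "x + of_real N \<in> P"
    using arch_plus by blast
  have "approx (f * (x + of_real N) + - (f * of_real N)) (0 + - 0)"
    by (intro approx_add approx_uminus approx_0_mult_P f N const)
  then show ?thesis
    by (simp add: algebra_simps)
qed

lemma approx_mult:
  assumes "approx f c" "approx g d"
  shows "approx (f * g) (c * d)"
proof -
  have "approx ((f - of_real c) * g + (g - of_real d) * of_real c) (0 + 0)"
    using assms by (intro approx_add approx_0_mult) (simp_all add: approx_shift_0)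
  moreover have "(f - of_real c) * g + (g - of_real d) * of_real c = f * g - of_real (c * d)"
    by (simp add: algebra_simps)
  ultimately have "approx (f * g - of_real (c * d)) 0"
    by (metis add.right_neutral)
  then show ?thesis
    by (simp only: approx_shift_0)
qed

lemma approx_of_real: "approx (of_real r) r"
  unfolding approx_def by (simp flip: of_real_diff add: of_real_mem_iff del: of_real_add)

lemma approx_nonneg:
  assumes "approx f c" "f \<in> Q"
  shows "0 \<le> c"
proof (rule field_le_epsilon)
  fix e :: real assume "e > 0"
  then have "of_real (c + e) - f \<in> Q"
    using assms by (simp add: approx_def)
  from Q_add[OF this assms(2)] show "0 \<le> c + e"
    by (simp add: of_real_mem_iff flip: of_real_add)
qed

context
  assumes maximal: "\<And>Q'. proper_module Q' \<Longrightarrow> Q \<subseteq> Q' \<Longrightarrow> Q' = Q"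
begin

text \<open>
  Otherwise the module generated by \<open>Q\<close> and \<open>f\<close> would be a larger proper one.
\<close>

lemma adjoin_improper:
  assumes "f \<notin> Q"
  shows "\<exists>q\<in>Q. \<exists>p\<in>P. - 1 = q + p * f"
proof (rule ccontr)
  assume no: "\<not> ?thesis"
  define Q' where "Q' = {q + p * f | q p. q \<in> Q \<and> p \<in> P}"
  have zero: "0 \<in> P" and one: "1 \<in> P"
    using const[of 0] const[of 1] by simp_all
  have sub: "Q \<subseteq> Q'"
  proof
    fix q assume "q \<in> Q"
    then have "q + 0 * f \<in> Q'"
      unfolding Q'_def using zero by blast
    then show "q \<in> Q'" by simp
  qed
  have "proper_module Q'"
    unfolding proper_module_def
  proof (intro conjI ballI)
    show "P \<subseteq> Q'" using sub P_subset by auto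
    show "- 1 \<notin> Q'" using no by (auto simp: Q'_def)
  next
    fix x y assume "x \<in> Q'" "y \<in> Q'"
    then obtain q p q' p' where "q \<in> Q" "p \<in> P" "q' \<in> Q" "p' \<in> P" and
      xy: "x = q + p * f" "y = q' + p' * f"
      by (auto simp: Q'_def)
    moreover have "x + y = (q + q') + (p + p') * f"
      by (simp add: xy algebra_simps)
    ultimately show "x + y \<in> Q'"
      unfolding Q'_def using Q_add add by blast
  next
    fix r x assume "r \<in> P" "x \<in> Q'"
    then obtain q p where "q \<in> Q" "p \<in> P" and x: "x = q + p * f"
      by (auto simp: Q'_def)
    moreover have "r * x = r * q + (r * p) * f"
      by (simp add: x algebra_simps)
    ultimately show "r * x \<in> Q'"
      unfolding Q'_def using \<open>r \<in> P\<close> Q_mult mult by blast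
  qed
  then have "Q' = Q"
    using maximal sub by blast
  moreover have "0 + 1 * f \<in> Q'"
    unfolding Q'_def using one zero P_subset by blast
  ultimately show False
    using assms by simp
qed

text \<open>
  If neither \<open>f\<close> nor \<open>- f\<close> were in \<open>Q\<close>, then \<open>- 1 = q1 + p1 f\<close> and \<open>- 1 = q2 - p2 f\<close>. Eliminating \<open>f\<close> shows
  \<open>- p1 \<in> Q\<close>. As \<open>f\<close> is the difference of \<open>f + N \<in> P\<close> and a constant \<open>N \<ge> 0\<close>, this puts \<open>p1 f\<close>, and with it
  \<open>- 1\<close>, into \<open>Q\<close>.
\<close>

lemma maximal_total: "f \<in> Q \<or> - f \<in> Q"
proof (rule ccontr)
  assume "\<not> ?thesis"
  then obtain q1 p1 q2 p2 where
    mem: "q1 \<in> Q" "p1 \<in> P" "q2 \<in> Q" "p2 \<in> P" and e1: "- 1 = q1 + p1 * f" and e2: "- 1 = q2 + p2 * - f"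
    using adjoin_improper[of f] adjoin_improper[of "- f"] by blast
  have "- p1 - p2 = p2 * (q1 + p1 * f) + p1 * (q2 + p2 * - f)"
    unfolding e1[symmetric] e2[symmetric] by simp
  then have "- p1 = p2 * q1 + p1 * q2 + p2"
    by (simp add: algebra_simps)
  then have neg: "- p1 \<in> Q"
    using mem by (simp add: Q_add Q_mult P_subset)
  obtain N where N: "N \<ge> 0" "f + of_real N \<in> P"
    using arch_plus by blast
  have "q1 + (f + of_real N) * p1 + of_real N * (- p1) \<in> Q"
    using N mem neg by (intro Q_add Q_mult const) (auto intro: P_subset)
  moreover have "q1 + (f + of_real N) * p1 + of_real N * (- p1) = - 1"
    by (simp add: e1 algebra_simps)
  ultimately show False
    using minus_one by simp
qed

text \<open>
  The value is the greatest lower bound of the constants above \<open>f\<close>. It exists by the Archimedean axiom,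
  and totality of \<open>Q\<close> turns "no smaller constant lies above \<open>f\<close>" into "smaller constants lie below
  \<open>f\<close>".
\<close>

lemma approx_exists: "\<exists>c. approx f c"
proof -
  define S where "S = {r. of_real r - f \<in> Q}"
  obtain N M where N: "N \<ge> 0" "of_real N - f \<in> P" and M: "M \<ge> 0" "f + of_real M \<in> P"
    using arch arch_plus by metis
  have ne: "S \<noteq> {}"
    using N P_subset by (auto simp: S_def)
  have "- M \<le> r" if "r \<in> S" for r
  proof -
    have "of_real (r + M) \<in> Q"
      using Q_add[of "of_real r - f" "f + of_real M"] that M P_subset by (simp add: S_def)
    then show ?thesis
      by (simp only: of_real_mem_iff)
  qed
  then have bdd: "bdd_below S"
    by (auto simp: bdd_below_def)
  have "approx f (Inf S)"
    unfolding approx_def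
  proof (intro allI impI conjI)
    fix e :: real assume e: "e > 0"
    then obtain r where r: "r \<in> S" "r < Inf S + e"
      using cInf_lessD[OF ne, of "Inf S + e"] by auto
    then have "of_real (Inf S + e - r) + (of_real r - f) \<in> Q"
      by (intro Q_add) (simp_all only: of_real_mem_iff, simp_all add: S_def)
    moreover have "of_real (Inf S + e - r) + (of_real r - f) = of_real (Inf S + e) - f"
      by simp
    ultimately show "of_real (Inf S + e) - f \<in> Q"
      by metis
    have "Inf S - e \<notin> S"
      using cInf_lower[OF _ bdd, of "Inf S - e"] e by auto
    then show "f - of_real (Inf S - e) \<in> Q"
      using maximal_total[of "f - of_real (Inf S - e)"] by (simp add: S_def)
  qed
  then show ?thesis ..
qed

lemma maximal_module_character: "\<exists>\<alpha>\<in>characters. \<forall>q\<in>Q. 0 \<le> \<alpha> q"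
proof -
  obtain \<alpha> where \<alpha>: "\<And>f. approx f (\<alpha> f)"
    using approx_exists by metis
  have eq: "\<alpha> f = c" if "approx f c" for f c
    using approx_unique[OF \<alpha> that] .
  have mult: "\<alpha> (f * g) = \<alpha> f * \<alpha> g" for f g
    using \<alpha> by (intro eq approx_mult)
  have real: "\<alpha> (of_real r) = r" for r
    by (intro eq approx_of_real)
  have "linear \<alpha>"
  proof (rule linearI)
    show "\<alpha> (f + g) = \<alpha> f + \<alpha> g" for f g
      using \<alpha> by (intro eq approx_add)
    show "\<alpha> (r *\<^sub>R f) = r *\<^sub>R \<alpha> f" for r f
      by (simp add: scaleR_conv_of_real mult real)
  qed
  then have "\<alpha> \<in> characters"
    using mult real[of 1] by (simp add: characters_def)
  then show ?thesis
    using \<alpha> approx_nonneg by blast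
qed

end

end

lemma proper_module_character:
  assumes "proper_module Q"
  shows "\<exists>\<alpha>\<in>characters. \<forall>q\<in>Q. 0 \<le> \<alpha> q"
proof -
  define \<A> where "\<A> = {M. proper_module M \<and> Q \<subseteq> M}"
  have "\<exists>M\<in>\<A>. \<forall>X\<in>\<A>. M \<subseteq> X \<longrightarrow> X = M"
  proof (rule subset_Zorn_nonempty)
    show "\<A> \<noteq> {}"
      using assms by (auto simp: \<A>_def)
    fix \<C> assume ne: "\<C> \<noteq> {}" and ch: "subset.chain \<A> \<C>"
    then have sub: "\<C> \<subseteq> \<A>" and tot: "\<And>X Y. X \<in> \<C> \<Longrightarrow> Y \<in> \<C> \<Longrightarrow> X \<subseteq> Y \<or> Y \<subseteq> X"
      by (auto simp: subset_chain_def)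
    have pm: "proper_module M" if "M \<in> \<C>" for M
      using that sub by (auto simp: \<A>_def)
    have "proper_module (\<Union>\<C>)"
      unfolding proper_module_def
    proof (intro conjI ballI)
      obtain M where "M \<in> \<C>"
        using ne by blast
      then show "P \<subseteq> \<Union>\<C>"
        using pm[of M] unfolding proper_module_def by blast
      show "- 1 \<notin> \<Union>\<C>"
        using pm by (auto simp: proper_module_def)
    next
      fix x y assume "x \<in> \<Union>\<C>" "y \<in> \<Union>\<C>"
      then obtain X Y where "X \<in> \<C>" "x \<in> X" "Y \<in> \<C>" "y \<in> Y"
        by blast
      then obtain M where "M \<in> \<C>" "x \<in> M" "y \<in> M"
        using tot[of X Y] by blast
      then show "x + y \<in> \<Union>\<C>"
        using pm[of M] unfolding proper_module_def by blast
    next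
      fix p x assume "p \<in> P" "x \<in> \<Union>\<C>"
      then obtain M where "M \<in> \<C>" "x \<in> M"
        by blast
      then show "p * x \<in> \<Union>\<C>"
        using pm[of M] \<open>p \<in> P\<close> unfolding proper_module_def by blast
    qed
    moreover have "Q \<subseteq> \<Union>\<C>"
      using ne sub unfolding \<A>_def by blast
    ultimately show "\<Union>\<C> \<in> \<A>"
      by (simp add: \<A>_def)
  qed
  then obtain M where M: "M \<in> \<A>" and max: "\<forall>X\<in>\<A>. M \<subseteq> X \<longrightarrow> X = M" ..
  then have proper: "proper_module M" and sub: "Q \<subseteq> M"
    by (simp_all add: \<A>_def)
  have "X = M" if "proper_module X" "M \<subseteq> X" for X
    using that sub max by (simp add: \<A>_def)
  from maximal_module_character[OF proper this] show ?thesis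
    using sub by blast
qed

text \<open>
  The Archimedean Positivstellensatz. The module \<open>P - P f\<close> contains \<open>- f\<close>, so a character nonnegative on it
  would contradict the hypothesis. Hence it is improper, which means \<open>p' f = 1 + p\<close> with \<open>p, p' \<in> P\<close>. To
  get rid of the denominator \<open>p'\<close>, choose \<open>N\<close> with \<open>N - p' \<in> P\<close>; then
  \<open>N (f + k) - 1 = (N - p') (f + k) + p + p' k\<close> shows that \<open>f + k \<in> P\<close> with \<open>k \<ge> 0\<close> implies
  \<open>f + (k - 1/N) \<in> P\<close>. Starting from some large \<open>k\<close>, finitely many such steps lead to \<open>f \<in> P\<close>.
\<close>

theorem positive_on_characters_imp_mem:
  assumes pos: "\<And>\<alpha>. \<alpha> \<in> characters \<Longrightarrow> \<forall>p\<in>P. 0 \<le> \<alpha> p \<Longrightarrow> 0 < \<alpha> f"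
  shows "f \<in> P"
proof -
  define Q where "Q = {p - p' * f | p p'. p \<in> P \<and> p' \<in> P}"
  have zero: "0 \<in> P" and one: "1 \<in> P"
    using const[of 0] const[of 1] by simp_all
  have sub: "P \<subseteq> Q"
  proof
    fix p assume "p \<in> P"
    then have "p - 0 * f \<in> Q"
      unfolding Q_def using zero by blast
    then show "p \<in> Q" by simp
  qed
  have "0 - 1 * f \<in> Q"
    unfolding Q_def using zero one by blast
  then have f: "- f \<in> Q" by simp
  have "\<not> proper_module Q"
  proof
    assume "proper_module Q"
    then obtain \<alpha> where \<alpha>: "\<alpha> \<in> characters" "\<forall>q\<in>Q. 0 \<le> \<alpha> q"
      using proper_module_character by blast
    then have "0 < \<alpha> f"
      using sub pos by blast
    moreover have "0 \<le> \<alpha> (- f)" "\<alpha> (- f) = - \<alpha> f"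
      using \<alpha> f by (auto simp: characters_def linear_neg)
    ultimately show False by simp
  qed
  moreover have "x + y \<in> Q" if "x \<in> Q" "y \<in> Q" for x y
  proof -
    from that obtain q p q' p' where "q \<in> P" "p \<in> P" "q' \<in> P" "p' \<in> P" and
      xy: "x = q - p * f" "y = q' - p' * f"
      by (auto simp: Q_def)
    moreover have "x + y = (q + q') - (p + p') * f"
      by (simp add: xy algebra_simps)
    ultimately show ?thesis
      unfolding Q_def using add by blast
  qed
  moreover have "r * x \<in> Q" if "r \<in> P" "x \<in> Q" for r x
  proof -
    from that obtain q p where "q \<in> P" "p \<in> P" and x: "x = q - p * f"
      by (auto simp: Q_def)
    moreover have "r * x = r * q - (r * p) * f"
      by (simp add: x algebra_simps)
    ultimately show ?thesis
      unfolding Q_def using that mult by blast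
  qed
  ultimately have "- 1 \<in> Q"
    using sub unfolding proper_module_def by blast
  then obtain p p' where p: "p \<in> P" "p' \<in> P" and eq: "- 1 = p - p' * f"
    unfolding Q_def by blast
  then have eq: "p' * f = 1 + p"
    by (metis add_diff_cancel_left' diff_add_cancel minus_diff_eq uminus_add_conv_diff)
  obtain N0 where N0: "N0 \<ge> 0" "of_real N0 - p' \<in> P"
    using arch by blast
  \<comment> \<open>one more than the given bound, to be able to divide by it\<close>
  define N where "N = N0 + 1"
  have N: "N > 0" "of_real N - p' \<in> P"
    using N0 add[OF N0(2) const[of 1]] by (auto simp: N_def algebra_simps)
  have step: "f + of_real (k - 1 / N) \<in> P" if k: "0 \<le> k" "f + of_real k \<in> P" for k
  proof -
    have "1 / N * N = 1"
      using N by simp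
    then have inv: "of_real (1 / N) * of_real N = (1 :: 'a)"
      by (metis of_real_1 of_real_mult)
    have "(of_real N - p') * (f + of_real k) + p + p' * of_real k = of_real N * (f + of_real k) - 1"
      using eq by (simp add: algebra_simps)
    then have "of_real (1 / N) * ((of_real N - p') * (f + of_real k) + p + p' * of_real k)
        = of_real (1 / N) * of_real N * (f + of_real k) - of_real (1 / N)"
      by (simp only: right_diff_distrib mult.assoc mult_1_right)
    then have "of_real (1 / N) * ((of_real N - p') * (f + of_real k) + p + p' * of_real k)
        = f + of_real (k - 1 / N)"
      unfolding inv by simp
    moreover have "of_real (1 / N) * ((of_real N - p') * (f + of_real k) + p + p' * of_real k) \<in> P"
    proof (intro mult[of "of_real (1 / N)"] add)
      show "of_real (1 / N) \<in> P"
        using N by (intro const) simp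
      show "(of_real N - p') * (f + of_real k) \<in> P" "p' * of_real k \<in> P"
        by (rule mult[OF N(2) k(2)], rule mult[OF p(2) const[OF k(1)]])
    qed (fact p(1))
    ultimately show ?thesis
      by (simp only:)
  qed
  obtain k0 where k0: "k0 \<ge> 0" "f + of_real k0 \<in> P"
    using arch_plus by blast
  have "f \<in> P \<or> f + of_real (k0 - real n / N) \<in> P \<and> 0 \<le> k0 - real n / N" for n
  proof (induction n)
    case 0
    then show ?case using k0 by simp
  next
    case (Suc n)
    show ?case
    proof (cases "f \<in> P")
      case False
      with Suc have *: "f + of_real (k0 - real n / N) \<in> P" "0 \<le> k0 - real n / N"
        by auto
      have eq: "k0 - real n / N - 1 / N = k0 - real (Suc n) / N"
        unfolding of_nat_Suc add_divide_distrib by linarith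
      have mem: "f + of_real (k0 - real (Suc n) / N) \<in> P"
        using step[OF *(2,1)] unfolding eq .
      have "0 \<le> k0 - real (Suc n) / N"
      proof (rule ccontr)
        assume "\<not> 0 \<le> k0 - real (Suc n) / N"
        then have "f + of_real (k0 - real (Suc n) / N) + of_real (- (k0 - real (Suc n) / N)) \<in> P"
          using mem by (intro add[OF mem] const) simp
        then show False
          using \<open>f \<notin> P\<close> by (simp only: of_real_minus add.assoc) simp
      qed
      with mem show ?thesis by blast
    qed simp
  qed
  moreover obtain n :: nat where "k0 * N < real n"
    using reals_Archimedean2 by blast
  then have "\<not> 0 \<le> k0 - real n / N"
    using N by (simp add: field_simps)
  ultimately show ?thesis by blast
qed

end

section \<open>Positive extension of linear functionals\<close>

definition sublinear :: "('v::real_vector \<Rightarrow> real) \<Rightarrow> bool" where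
  "sublinear p \<longleftrightarrow> (\<forall>x y. p (x + y) \<le> p x + p y) \<and> (\<forall>r\<ge>0. \<forall>x. p (r *\<^sub>R x) = r * p x)"

lemma sublinearI:
  assumes sub: "\<And>x y. p (x + y) \<le> p x + p y"
    and scale: "\<And>r x. 0 < r \<Longrightarrow> p (r *\<^sub>R x) \<le> r * p x"
    and zero: "p 0 = 0"
  shows "sublinear p"
proof -
  have "r * p x \<le> p (r *\<^sub>R x)" if "0 < r" for r x
    using scale[of "1 / r" "r *\<^sub>R x"] that by (simp add: field_simps)
  then have "p (r *\<^sub>R x) = r * p x" if "0 \<le> r" for r x
    using that scale zero by (cases "r = 0") (auto intro: antisym)
  then show ?thesis
    using sub by (auto simp: sublinear_def)
qed

lemma sublinear_add: "sublinear p \<Longrightarrow> p (x + y) \<le> p x + p y"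
  and sublinear_scale: "sublinear p \<Longrightarrow> 0 \<le> r \<Longrightarrow> p (r *\<^sub>R x) = r * p x"
  by (auto simp: sublinear_def)

lemma sublinear_0: "sublinear p \<Longrightarrow> p 0 = 0"
  using sublinear_scale[of p 0 0] by simp

lemma sublinear_lower: "sublinear p \<Longrightarrow> p y - p (- x) \<le> p (x + y)"
  using sublinear_add[of p "x + y" "- x"] by simp

text \<open>
  Zorn's lemma applies because the pointwise infimum of a chain of sublinear functionals below \<open>p\<close> is
  again sublinear; it is finite since \<open>- p (- x)\<close> is a common lower bound at \<open>x\<close>.
\<close>

lemma minimal_sublinear_exists:
  assumes p: "sublinear p"
  shows "\<exists>q. sublinear q \<and> q \<le> p \<and> (\<forall>r. sublinear r \<longrightarrow> r \<le> q \<longrightarrow> r = q)"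
proof -
  define A where "A = {q. sublinear q \<and> q \<le> p}"
  have "\<exists>m\<in>A. \<forall>a\<in>A. a \<le> m \<longrightarrow> a = m"
  proof (rule predicate_Zorn)
    show "partial_order_on A (relation_of (\<lambda>q r. r \<le> q) A)"
      by (rule partial_order_on_relation_ofI) auto
  next
    fix C assume C: "C \<in> Chains (relation_of (\<lambda>q r. r \<le> q) A)"
    show "\<exists>u\<in>A. \<forall>a\<in>C. u \<le> a"
    proof (cases "C = {}")
      case True
      then show ?thesis using p by (auto simp: A_def)
    next
      case False
      have CA: "C \<subseteq> A" and tot: "\<And>q r. q \<in> C \<Longrightarrow> r \<in> C \<Longrightarrow> q \<le> r \<or> r \<le> q"
        using C by (auto simp: Chains_def relation_of_def)
      have sl: "sublinear q" "q x \<le> p x" if "q \<in> C" for q x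
        using that CA by (auto simp: A_def le_fun_def)
      define u where "u x = (INF q\<in>C. q x)" for x
      have bdd: "bdd_below ((\<lambda>q. q x) ` C)" for x
      proof (rule bdd_belowI2)
        fix q assume q: "q \<in> C"
        show "- p (- x) \<le> q x"
          using sublinear_lower[OF sl(1)[OF q], of 0 x] sublinear_0[OF sl(1)[OF q]] sl(2)[OF q, of "- x"] by simp
      qed
      have le: "u x \<le> q x" if "q \<in> C" for q x
        unfolding u_def by (rule cINF_lower[OF bdd that])
      have ge: "c \<le> u x" if "\<And>q. q \<in> C \<Longrightarrow> c \<le> q x" for c x
        unfolding u_def by (rule cINF_greatest[OF False that])
      have "sublinear u"
      proof (rule sublinearI)
        fix x y
        have "u (x + y) \<le> q x + r y" if "q \<in> C" "r \<in> C" for q r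
        proof -
          have "q \<le> r \<or> r \<le> q" using tot that by blast
          then obtain s where s: "s \<in> C" "s \<le> q" "s \<le> r"
            using \<open>q \<in> C\<close> \<open>r \<in> C\<close> by (metis order_refl)
          have "u (x + y) \<le> s (x + y)"
            using le s by blast
          also have "\<dots> \<le> s x + s y"
            using sl s sublinear_add by blast
          also have "\<dots> \<le> q x + r y"
            using s by (auto simp: le_fun_def intro: add_mono)
          finally show ?thesis .
        qed
        then have "u (x + y) - r y \<le> u x" if "r \<in> C" for r
          using that by (intro ge) (simp add: algebra_simps)
        then have "u (x + y) - u x \<le> u y"
          by (intro ge) (simp add: algebra_simps)
        then show "u (x + y) \<le> u x + u y" by simp
      next
        fix t :: real and x assume t: "0 < t"
        have "u (t *\<^sub>R x) / t \<le> u x"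
        proof (rule ge)
          fix q assume q: "q \<in> C"
          have "u (t *\<^sub>R x) \<le> t * q x"
            using le[OF q, of "t *\<^sub>R x"] sublinear_scale[OF sl(1)[OF q], of t x] t by simp
          then show "u (t *\<^sub>R x) / t \<le> q x"
            using t by (simp add: field_simps)
        qed
        then show "u (t *\<^sub>R x) \<le> t * u x"
          using t by (simp add: field_simps)
      next
        have "u 0 = (INF q\<in>C. 0)"
          unfolding u_def using sl sublinear_0 by (intro INF_cong) auto
        then show "u 0 = 0"
          using False by simp
      qed
      moreover obtain q0 where "q0 \<in> C" using False by blast
      then have "u \<le> p"
        using le sl by (force simp: le_fun_def intro: order_trans)
      ultimately show ?thesis
        using le by (auto simp: A_def le_fun_def)
    qed
  qed
  then show ?thesis
    unfolding A_def by (metis (mono_tags, lifting) mem_Collect_eq order_trans)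
qed

text \<open>
  Given a direction \<open>y\<close>, the infimum over \<open>t \<ge> 0\<close> of \<open>q (x + t y) - t q y\<close> is a sublinear function of \<open>x\<close> below
  \<open>q\<close>. Minimality identifies it with \<open>q\<close>, and \<open>t = 1\<close> yields superadditivity.
\<close>

lemma minimal_sublinear_linear:
  assumes q: "sublinear q" and minimal: "\<And>r. sublinear r \<Longrightarrow> r \<le> q \<Longrightarrow> r = q"
  shows "linear q"
proof -
  have super: "q x + q y \<le> q (x + y)" for x y
  proof -
    define h where "h x t = q (x + t *\<^sub>R y) - t * q y" for x t
    define r where "r x = (INF t\<in>{0..}. h x t)" for x
    have bdd: "bdd_below (h x ` {0..})" for x
    proof (rule bdd_belowI2)
      fix t :: real assume "t \<in> {0..}"
      then show "- q (- x) \<le> h x t"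
        using sublinear_lower[OF q, of "t *\<^sub>R y" x] sublinear_scale[OF q, of t y] by (simp add: h_def)
    qed
    have le: "r x \<le> h x t" if "0 \<le> t" for x t
      unfolding r_def using that by (intro cINF_lower[OF bdd]) simp
    have ge: "c \<le> r x" if "\<And>t. 0 \<le> t \<Longrightarrow> c \<le> h x t" for c x
      unfolding r_def using that by (intro cINF_greatest) auto
    have "sublinear r"
    proof (rule sublinearI)
      fix x1 x2
      have "r (x1 + x2) \<le> h x1 s + h x2 t" if "0 \<le> s" "0 \<le> t" for s t
      proof -
        have "r (x1 + x2) \<le> h (x1 + x2) (s + t)"
          using that by (intro le) simp
        also have "\<dots> \<le> h x1 s + h x2 t"
          using sublinear_add[OF q, of "x1 + s *\<^sub>R y" "x2 + t *\<^sub>R y"]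
          by (simp add: h_def algebra_simps)
        finally show ?thesis .
      qed
      then have "r (x1 + x2) - h x2 t \<le> r x1" if "0 \<le> t" for t
        using that by (intro ge) (simp add: algebra_simps)
      then have "r (x1 + x2) - r x1 \<le> r x2"
        by (intro ge) (simp add: algebra_simps)
      then show "r (x1 + x2) \<le> r x1 + r x2" by simp
    next
      fix s :: real and x assume s: "0 < s"
      have "r (s *\<^sub>R x) / s \<le> r x"
      proof (rule ge)
        fix t :: real assume t: "0 \<le> t"
        have "h (s *\<^sub>R x) (s * t) = s * h x t"
          using sublinear_scale[OF q, of s "x + t *\<^sub>R y"] s by (simp add: h_def algebra_simps)
        then show "r (s *\<^sub>R x) / s \<le> h x t"
          using le[of "s * t" "s *\<^sub>R x"] s t by (simp add: field_simps)
      qed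
      then show "r (s *\<^sub>R x) \<le> s * r x"
        using s by (simp add: field_simps)
    next
      have "h 0 t = 0" if "0 \<le> t" for t
        using sublinear_scale[OF q that, of y] by (simp add: h_def)
      then show "r 0 = 0"
        by (simp add: r_def)
    qed
    moreover have "r \<le> q"
      using le[of 0] by (auto simp: le_fun_def h_def)
    ultimately have "r = q"
      by (rule minimal)
    then show ?thesis
      using le[of 1 x] by (simp add: h_def)
  qed
  have add: "q (x + y) = q x + q y" for x y
    using super sublinear_add[OF q] by (simp add: antisym)
  have neg: "q (- x) = - q x" for x
    using add[of x "- x"] sublinear_0[OF q] by simp
  have "q (r *\<^sub>R x) = r * q x" for r x
    using sublinear_scale[OF q, of r x] sublinear_scale[OF q, of "- r" x] neg[of "r *\<^sub>R x"]
    by (cases "0 \<le> r") auto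
  with add show ?thesis
    by (intro linearI) auto
qed

text \<open>
  The Hahn-Banach theorem in the form in which the values to be extended are encoded in \<open>p\<close>.
\<close>

theorem sublinear_dominates_linear:
  assumes "sublinear p"
  shows "\<exists>q. linear q \<and> (\<forall>x. q x \<le> p x)"
  using minimal_sublinear_exists[OF assms] minimal_sublinear_linear by (auto simp: le_fun_def)

text \<open>
  Functions are total, but only their restriction to \<open>K\<close> matters: by monotonicity, \<open>\<Phi>\<close> agrees on bounded
  functions that coincide on \<open>K\<close>.
\<close>

definition positive_functional_on :: "'b set \<Rightarrow> (('b \<Rightarrow> real) \<Rightarrow> real) \<Rightarrow> bool" where
  "positive_functional_on K \<Phi> \<longleftrightarrow>
     (\<forall>f g. bounded (f ` K) \<longrightarrow> bounded (g ` K) \<longrightarrow> \<Phi> (\<lambda>x. f x + g x) = \<Phi> f + \<Phi> g) \<and>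
     (\<forall>c f. bounded (f ` K) \<longrightarrow> \<Phi> (\<lambda>x. c * f x) = c * \<Phi> f) \<and>
     (\<forall>f g. bounded (f ` K) \<longrightarrow> bounded (g ` K) \<longrightarrow> (\<forall>x\<in>K. f x \<le> g x) \<longrightarrow> \<Phi> f \<le> \<Phi> g)"

text \<open>
  The functional \<open>p g = inf {L a | g \<le> E a on K}\<close> is sublinear on bounded functions. A linear \<open>q \<le> p\<close> satisfies
  \<open>q (E a) \<le> L a\<close> for \<open>a\<close> and for \<open>- a\<close>, hence extends \<open>L\<close>; and \<open>g \<le> 0\<close> gives \<open>q g \<le> p g \<le> L 0 = 0\<close>. The vector space
  of all bounded functions is realised as the bounded continuous functions on a discrete copy of the
  type.
\<close>

theorem positive_functional_extension:
  fixes L :: "'v::real_vector \<Rightarrow> real" and E :: "'v \<Rightarrow> 'b \<Rightarrow> real"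
  assumes L: "linear L" and E: "\<And>x. x \<in> K \<Longrightarrow> linear (\<lambda>a. E a x)"
    and bounded_E: "\<And>a. bounded (E a ` K)"
    and unit: "\<And>x. x \<in> K \<Longrightarrow> E u x = 1"
    and pos: "\<And>a. (\<And>x. x \<in> K \<Longrightarrow> 0 \<le> E a x) \<Longrightarrow> 0 \<le> L a"
  shows "\<exists>\<Phi>. positive_functional_on K \<Phi> \<and> (\<forall>a. \<Phi> (E a) = L a)"
proof -
  have E_add: "E (a + b) x = E a x + E b x" and E_scale: "E (r *\<^sub>R a) x = r * E a x"
    and E_neg: "E (- a) x = - E a x" and E_0: "E 0 x = 0"
    if "x \<in> K" for a b r x
    using linear_add[OF E[OF that]] linear_scale[OF E[OF that]] linear_neg[OF E[OF that]]
      linear_0[OF E[OF that]] by auto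
  define S where "S g = {a. \<forall>x\<in>K. apply_bcontfun g (discrete x) \<le> E a x}" for g :: "'b discrete \<Rightarrow>\<^sub>C real"
  define p where "p g = (INF a\<in>S g. L a)" for g
  have bound: "\<exists>M\<ge>0. \<forall>x. \<bar>apply_bcontfun g x\<bar> \<le> M" for g :: "'b discrete \<Rightarrow>\<^sub>C real"
    using norm_bounded[of g] norm_ge_zero[of g] by (metis real_norm_def)
  have ne: "S g \<noteq> {}" for g
  proof -
    obtain M where "\<forall>x. \<bar>apply_bcontfun g x\<bar> \<le> M" using bound by blast
    then have "M *\<^sub>R u \<in> S g"
      unfolding S_def using unit by (auto simp: E_scale abs_le_iff)
    then show ?thesis by blast
  qed
  have bdd: "bdd_below (L ` S g)" for g
  proof -
    obtain M where M: "\<forall>x. \<bar>apply_bcontfun g x\<bar> \<le> M" using bound by blast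
    show ?thesis
    proof (rule bdd_belowI2)
      fix a assume a: "a \<in> S g"
      have "0 \<le> L (a + M *\<^sub>R u)"
      proof (rule pos)
        fix x assume x: "x \<in> K"
        then have "- M \<le> apply_bcontfun g (discrete x)" "apply_bcontfun g (discrete x) \<le> E a x"
          using M a by (auto simp: S_def abs_le_iff minus_le_iff)
        then show "0 \<le> E (a + M *\<^sub>R u) x"
          using x unit by (simp add: E_add E_scale)
      qed
      then show "- (M * L u) \<le> L a"
        using L by (simp add: linear_add linear_scale)
    qed
  qed
  have le: "p g \<le> L a" if "a \<in> S g" for g a
    unfolding p_def by (rule cINF_lower[OF bdd that])
  have ge: "c \<le> p g" if "\<And>a. a \<in> S g \<Longrightarrow> c \<le> L a" for c g
    unfolding p_def by (rule cINF_greatest[OF ne that])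
  have "sublinear p"
  proof (rule sublinearI)
    fix g h
    have "p (g + h) \<le> L a + L b" if "a \<in> S g" "b \<in> S h" for a b
    proof -
      have "a + b \<in> S (g + h)"
        using that by (auto simp: S_def E_add intro: add_mono)
      then show ?thesis
        using le linear_add[OF L] by metis
    qed
    then have "p (g + h) - L b \<le> p g" if "b \<in> S h" for b
      using that by (intro ge) (simp add: algebra_simps)
    then have "p (g + h) - p g \<le> p h"
      by (intro ge) (simp add: algebra_simps)
    then show "p (g + h) \<le> p g + p h" by simp
  next
    fix r :: real and g assume r: "0 < r"
    have "p (r *\<^sub>R g) / r \<le> p g"
    proof (rule ge)
      fix a assume "a \<in> S g"
      then have "r *\<^sub>R a \<in> S (r *\<^sub>R g)"
        using r by (auto simp: S_def E_scale)
      then have "p (r *\<^sub>R g) \<le> r * L a"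
        using le linear_scale[OF L, of r a] by (metis real_scaleR_def)
      then show "p (r *\<^sub>R g) / r \<le> L a"
        using r by (simp add: field_simps)
    qed
    then show "p (r *\<^sub>R g) \<le> r * p g"
      using r by (simp add: field_simps)
  next
    have "0 \<in> S 0" by (simp add: S_def E_0)
    then have "p 0 \<le> 0" using le[of 0 0] linear_0[OF L] by simp
    moreover have "0 \<le> p 0"
      by (intro ge pos) (simp add: S_def)
    ultimately show "p 0 = 0" by simp
  qed
  then obtain q where q: "linear q" "\<And>g. q g \<le> p g"
    using sublinear_dominates_linear by blast
  \<comment> \<open>extension by zero outside \<open>K\<close>, where \<open>f\<close> may be unbounded\<close>
  define J where "J f = Bcontfun (\<lambda>d. if of_discrete d \<in> K then f (of_discrete d) else 0)" for f :: "'b \<Rightarrow> real"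
  have J: "apply_bcontfun (J f) d = (if of_discrete d \<in> K then f (of_discrete d) else 0)"
    if f: "bounded (f ` K)" for f d
  proof -
    have "(\<lambda>d. if of_discrete d \<in> K then f (of_discrete d) else 0) \<in> bcontfun"
      unfolding bcontfun_def
    proof (intro CollectI conjI)
      show "continuous_on UNIV (\<lambda>d. if of_discrete d \<in> K then f (of_discrete d) else 0)"
        by (simp add: continuous_on_open_vimage open_discrete)
      have "range (\<lambda>d. if of_discrete d \<in> K then f (of_discrete d) else 0) \<subseteq> insert 0 (f ` K)"
        by auto
      then show "bounded (range (\<lambda>d. if of_discrete d \<in> K then f (of_discrete d) else 0))"
        using f bounded_subset by (metis bounded_insert)
    qed
    then show ?thesis
      by (simp add: J_def Bcontfun_inverse)
  qed
  have in_K: "of_discrete (discrete x) = x" for x :: 'b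
    by (simp add: discrete_inverse)
  have mono: "q g \<le> 0" if "\<And>x. x \<in> K \<Longrightarrow> apply_bcontfun g (discrete x) \<le> 0" for g
  proof -
    have "0 \<in> S g" using that by (simp add: S_def E_0)
    then show ?thesis using le[of 0 g] q(2)[of g] linear_0[OF L] by simp
  qed
  define \<Phi> where "\<Phi> f = q (J f)" for f
  have "positive_functional_on K \<Phi>"
    unfolding positive_functional_on_def
  proof (intro conjI allI impI)
    fix f g :: "'b \<Rightarrow> real" assume fg: "bounded (f ` K)" "bounded (g ` K)"
    have "J (\<lambda>x. f x + g x) = J f + J g"
      using fg by (intro bcontfun_eqI) (simp add: J bounded_plus_comp)
    then show "\<Phi> (\<lambda>x. f x + g x) = \<Phi> f + \<Phi> g"
      using q by (simp add: \<Phi>_def linear_add)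
    assume "\<forall>x\<in>K. f x \<le> g x"
    then have "q (J f - J g) \<le> 0"
      using fg by (intro mono) (simp add: J in_K)
    then show "\<Phi> f \<le> \<Phi> g"
      using q by (simp add: \<Phi>_def linear_diff)
  next
    fix c :: real and f :: "'b \<Rightarrow> real" assume f: "bounded (f ` K)"
    then have "bounded ((\<lambda>x. c * f x) ` K)"
      using bounded_scaleR_comp[of f K c] by simp
    then have "J (\<lambda>x. c * f x) = c *\<^sub>R J f"
      using f by (intro bcontfun_eqI) (simp add: J)
    then show "\<Phi> (\<lambda>x. c * f x) = c * \<Phi> f"
      using q by (simp add: \<Phi>_def linear_scale)
  qed
  moreover have "\<Phi> (E a) = L a" for a
  proof (rule antisym)
    have "a \<in> S (J (E a))"
      using bounded_E by (simp add: S_def J in_K)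
    then show "\<Phi> (E a) \<le> L a"
      unfolding \<Phi>_def using le q by (meson order_trans)
    have "- a \<in> S (- J (E a))"
      using bounded_E by (simp add: S_def J in_K E_neg)
    then have "q (- J (E a)) \<le> L (- a)"
      using le q by (meson order_trans)
    then show "L a \<le> \<Phi> (E a)"
      using q L by (simp add: \<Phi>_def linear_neg)
  qed
  ultimately show ?thesis by blast
qed

section \<open>Radon measures from finitely additive set functions\<close>

text \<open>
  A finite, finitely additive set function on all subsets that is concentrated on a compact set.
\<close>

locale charge_on_compact =
  fixes X :: "'b topology" and K :: "'b set" and c :: "'b set \<Rightarrow> ennreal"
  assumes hausdorff: "Hausdorff_space X"
    and compact_K: "compactin X K"
    and finite_charge: "c E < top"
    and charge_mono: "E \<inter> K \<subseteq> F \<Longrightarrow> c E \<le> c F"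
    and charge_disjoint_Un: "E \<inter> F = {} \<Longrightarrow> c (E \<union> F) = c E + c F"
begin

lemma charge_empty [simp]: "c {} = 0"
  using charge_disjoint_Un[of "{}" "{}"] finite_charge[of "{}"]
  by (cases "c {}") (auto simp flip: ennreal_plus)

lemma charge_Un_le: "c (E \<union> F) \<le> c E + c F"
proof -
  have "c (E \<union> F) = c (E \<union> (F - E))"
    by simp
  also have "\<dots> = c E + c (F - E)"
    by (rule charge_disjoint_Un) auto
  also have "\<dots> \<le> c E + c F"
    by (intro add_mono charge_mono) auto
  finally show ?thesis .
qed

text \<open>
  The two regularisations: \<open>inner_charge\<close> is used on open sets, \<open>outer_charge\<close> on arbitrary ones.
\<close>

definition inner_charge :: "'b set \<Rightarrow> ennreal" where
  "inner_charge U = (SUP C\<in>{C. compactin X C \<and> C \<subseteq> U}. c C)"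

definition outer_charge :: "'b set \<Rightarrow> ennreal" where
  "outer_charge E = (INF U\<in>{U. openin X U \<and> E \<subseteq> U}. inner_charge U)"

lemma charge_le_inner: "compactin X C \<Longrightarrow> C \<subseteq> U \<Longrightarrow> c C \<le> inner_charge U"
  unfolding inner_charge_def by (rule SUP_upper) auto

lemma inner_le_charge: "inner_charge U \<le> c U"
  unfolding inner_charge_def by (rule SUP_least) (auto intro: charge_mono)

lemma inner_mono: "U \<subseteq> V \<Longrightarrow> inner_charge U \<le> inner_charge V"
  unfolding inner_charge_def by (rule SUP_subset_mono) auto

lemma inner_leI: "(\<And>C. compactin X C \<Longrightarrow> C \<subseteq> U \<Longrightarrow> c C \<le> b) \<Longrightarrow> inner_charge U \<le> b"
  unfolding inner_charge_def by (rule SUP_least) auto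

lemma outer_le_inner: "openin X U \<Longrightarrow> E \<subseteq> U \<Longrightarrow> outer_charge E \<le> inner_charge U"
  unfolding outer_charge_def by (rule INF_lower) auto

lemma outer_open: "openin X U \<Longrightarrow> outer_charge U = inner_charge U"
  unfolding outer_charge_def by (rule antisym) (auto intro!: INF_lower INF_greatest inner_mono)

lemma outer_mono: "E \<subseteq> F \<Longrightarrow> outer_charge E \<le> outer_charge F"
  unfolding outer_charge_def by (rule INF_superset_mono) auto

lemma outer_finite: "outer_charge E < top" if "E \<subseteq> topspace X"
  using outer_le_inner[OF openin_topspace that] inner_le_charge[of "topspace X"] finite_charge[of "topspace X"]
  by (meson le_less_trans)

text \<open>
  The compact sets \<open>C - U\<close> and \<open>C - V\<close> are disjoint; removing disjoint open neighbourhoods of them from \<open>C\<close>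
  leaves the two pieces.
\<close>

lemma compact_split:
  assumes C: "compactin X C" and UV: "openin X U" "openin X V" "C \<subseteq> U \<union> V"
  obtains D E where "compactin X D" "compactin X E" "D \<subseteq> U" "E \<subseteq> V" "C = D \<union> E"
proof -
  have diff: "compactin X (C - W)" if "openin X W" for W
    using closed_compactin[OF C, of "C - W"] compactin_imp_closedin[OF hausdorff C] that
    by (simp add: closedin_diff)
  have "disjnt (C - U) (C - V)"
    using UV by (auto simp: disjnt_iff)
  then obtain U' V' where W: "openin X U'" "openin X V'" "C - U \<subseteq> U'" "C - V \<subseteq> V'" "disjnt U' V'"
    using Hausdorff_space_compact_separation[OF hausdorff diff diff] UV by metis
  show thesis
  proof
    show "compactin X (C - U')" "compactin X (C - V')"
      using W diff by auto
    show "C - U' \<subseteq> U" "C - V' \<subseteq> V" "C = (C - U') \<union> (C - V')"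
      using W by (auto simp: disjnt_iff)
  qed
qed

lemma inner_Un_le:
  assumes "openin X U" "openin X V"
  shows "inner_charge (U \<union> V) \<le> inner_charge U + inner_charge V"
proof (rule inner_leI)
  fix C assume "compactin X C" "C \<subseteq> U \<union> V"
  then obtain D E where DE: "compactin X D" "compactin X E" "D \<subseteq> U" "E \<subseteq> V" "C = D \<union> E"
    using compact_split assms by metis
  then have "c C \<le> c D + c E"
    using charge_Un_le by blast
  also have "\<dots> \<le> inner_charge U + inner_charge V"
    using DE by (intro add_mono charge_le_inner)
  finally show "c C \<le> inner_charge U + inner_charge V" .
qed

lemma inner_empty [simp]: "inner_charge {} = 0"
  using inner_le_charge[of "{}"] by simp

lemma inner_finite_UN_le:
  assumes "\<And>i. openin X (U i)" "finite I"
  shows "inner_charge (\<Union>i\<in>I. U i) \<le> (\<Sum>i\<in>I. inner_charge (U i))"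
  using assms(2)
proof (induction I rule: finite_induct)
  case (insert i I)
  have "inner_charge (\<Union>i\<in>insert i I. U i) \<le> inner_charge (U i) + inner_charge (\<Union>i\<in>I. U i)"
    using inner_Un_le[of "U i" "\<Union>i\<in>I. U i"] assms(1) by auto
  also have "\<dots> \<le> inner_charge (U i) + (\<Sum>i\<in>I. inner_charge (U i))"
    using insert.IH by (rule add_left_mono)
  finally show ?case
    using insert.hyps by simp
qed simp

text \<open>
  Compactness reduces countable subadditivity to the finite case. This is the only source of
  \<open>\<sigma>\<close>-additivity, as the charge itself is merely finitely additive.
\<close>

lemma inner_UN_le:
  fixes U :: "nat \<Rightarrow> 'b set"
  assumes U: "\<And>i. openin X (U i)"
  shows "inner_charge (\<Union>i. U i) \<le> (\<Sum>i. inner_charge (U i))"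
proof (rule inner_leI)
  fix C assume C: "compactin X C" "C \<subseteq> (\<Union>i. U i)"
  then obtain \<F> where "finite \<F>" "\<F> \<subseteq> range U" "C \<subseteq> \<Union>\<F>"
    using U unfolding compactin_def by (metis (no_types, lifting) imageE)
  then obtain I where I: "finite I" "C \<subseteq> (\<Union>i\<in>I. U i)"
    by (metis finite_subset_image)
  have "c C \<le> (\<Sum>i\<in>I. inner_charge (U i))"
    using charge_le_inner[OF C(1) I(2)] inner_finite_UN_le[OF U I(1)] by (rule order_trans)
  also have "\<dots> \<le> (\<Sum>i. inner_charge (U i))"
    by (rule sum_le_suminf) (use I in auto)
  finally show "c C \<le> (\<Sum>i. inner_charge (U i))" .
qed

lemma outer_measure_space_outer: "outer_measure_space (Pow (topspace X)) outer_charge"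
  unfolding outer_measure_space_def
proof (intro conjI)
  show "positive (Pow (topspace X)) outer_charge"
    by (simp add: positive_def outer_open)
  show "increasing (Pow (topspace X)) outer_charge"
    by (simp add: increasing_def outer_mono)
  show "countably_subadditive (Pow (topspace X)) outer_charge"
    unfolding countably_subadditive_def
  proof (intro allI impI)
    fix A :: "nat \<Rightarrow> 'b set"
    assume A: "range A \<subseteq> Pow (topspace X)"
    show "outer_charge (\<Union>i. A i) \<le> (\<Sum>i. outer_charge (A i))"
    proof (rule ennreal_le_epsilon)
      fix e :: real assume e: "0 < e"
      have "\<exists>U. openin X U \<and> A n \<subseteq> U \<and> inner_charge U \<le> outer_charge (A n) + e * (1/2) ^ Suc n" for n
      proof -
        have "A n \<subseteq> topspace X"
          using A by auto
        then have "outer_charge (A n) < outer_charge (A n) + e * (1/2) ^ Suc n"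
          using outer_finite[of "A n"] e by (simp add: less_top)
        then obtain U where "openin X U" "A n \<subseteq> U" "inner_charge U < outer_charge (A n) + e * (1/2) ^ Suc n"
          by (subst (asm) (1) outer_charge_def) (auto simp: INF_less_iff)
        then show ?thesis by (auto intro: less_imp_le)
      qed
      then obtain U where U: "\<And>n. openin X (U n)" "\<And>n. A n \<subseteq> U n"
        "\<And>n. inner_charge (U n) \<le> outer_charge (A n) + e * (1/2) ^ Suc n"
        by metis
      have "outer_charge (\<Union>i. A i) \<le> inner_charge (\<Union>i. U i)"
        using U by (intro outer_le_inner) auto
      also have "\<dots> \<le> (\<Sum>i. inner_charge (U i))"
        by (rule inner_UN_le[OF U(1)])
      also have "\<dots> \<le> (\<Sum>n. outer_charge (A n) + e * (1/2) ^ Suc n)"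
        by (intro suminf_le U) auto
      also have "\<dots> = (\<Sum>n. outer_charge (A n)) + (\<Sum>n. ennreal e * ennreal ((1/2) ^ Suc n))"
        using e by (subst suminf_add[symmetric])
          (auto simp del: ennreal_suminf_cmult simp add: ennreal_mult[symmetric])
      also have "\<dots> = (\<Sum>n. outer_charge (A n)) + e"
        unfolding ennreal_suminf_cmult
        by (subst suminf_ennreal_eq[OF zero_le_power power_half_series]) auto
      finally show "outer_charge (\<Union>i. A i) \<le> (\<Sum>n. outer_charge (A n)) + e" .
    qed
  qed
qed

lemma outer_Un_le:
  assumes "E \<subseteq> topspace X" "F \<subseteq> topspace X" "E \<inter> F = {}"
  shows "outer_charge (E \<union> F) \<le> outer_charge E + outer_charge F"
proof -
  have "subadditive (Pow (topspace X)) outer_charge"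
    using outer_measure_space_outer ring_of_sets.countably_subadditive_subadditive[of "topspace X" "Pow (topspace X)" outer_charge]
      ring_of_sets_Pow by (auto simp: outer_measure_space_def)
  then show ?thesis
    using assms by (auto dest: subadditiveD)
qed

text \<open>
  This is the Caratheodory condition for open sets. For open \<open>U \<supseteq> E\<close>, exhaust \<open>U \<inter> V\<close> by a compact \<open>C\<close>, and then
  the open set \<open>U - C \<supseteq> U - V\<close> by a compact \<open>D\<close>. These are disjoint subsets of \<open>U\<close>, so that additivity of
  the charge bounds \<open>c C + c D\<close> by the inner charge of \<open>U\<close>.
\<close>

lemma outer_open_split:
  assumes V: "openin X V" and E: "E \<subseteq> topspace X"
  shows "outer_charge (E \<inter> V) + outer_charge (E - V) \<le> outer_charge E"
  unfolding outer_charge_def[of E]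
proof (rule INF_greatest, safe)
  fix U assume U: "openin X U" "E \<subseteq> U"
  have "c C + outer_charge (U - V) \<le> inner_charge U" if C: "compactin X C" "C \<subseteq> U \<inter> V" for C
  proof -
    have ne: "{D. compactin X D \<and> D \<subseteq> U - C} \<noteq> {}"
      using compactin_empty by blast
    have "openin X (U - C)"
      using U compactin_imp_closedin[OF hausdorff C(1)] by (simp add: openin_diff)
    then have "outer_charge (U - V) \<le> inner_charge (U - C)"
      using C by (intro outer_le_inner) auto
    then have "c C + outer_charge (U - V) \<le> (SUP D\<in>{D. compactin X D \<and> D \<subseteq> U - C}. c C + c D)"
      unfolding inner_charge_def ennreal_SUP_add_right[OF ne, symmetric] by (rule add_left_mono)
    also have "\<dots> \<le> inner_charge U"
    proof (rule SUP_least)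
      fix D assume D: "D \<in> {D. compactin X D \<and> D \<subseteq> U - C}"
      then have "c C + c D = c (C \<union> D)"
        by (intro charge_disjoint_Un[symmetric]) auto
      also have "\<dots> \<le> inner_charge U"
        using C D by (intro charge_le_inner compactin_Un) auto
      finally show "c C + c D \<le> inner_charge U" .
    qed
    finally show ?thesis .
  qed
  moreover have "{C. compactin X C \<and> C \<subseteq> U \<inter> V} \<noteq> {}"
    using compactin_empty by blast
  ultimately have "inner_charge (U \<inter> V) + outer_charge (U - V) \<le> inner_charge U"
    unfolding inner_charge_def[of "U \<inter> V"]
    by (subst ennreal_SUP_add_left[symmetric]) (auto intro: SUP_least)
  moreover have "outer_charge (E \<inter> V) \<le> inner_charge (U \<inter> V)" "outer_charge (E - V) \<le> outer_charge (U - V)"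
    using U V by (auto intro!: outer_le_inner outer_mono)
  ultimately show "outer_charge (E \<inter> V) + outer_charge (E - V) \<le> inner_charge U"
    by (meson add_mono order_trans)
qed

definition radon :: "'b measure" where
  "radon = measure_of (topspace X) (sigma_sets (topspace X) {U. openin X U}) outer_charge"

lemma opens_Pow: "{U. openin X U} \<subseteq> Pow (topspace X)"
  by (auto dest: openin_subset)

lemma sets_radon: "sets radon = sigma_sets (topspace X) {U. openin X U}"
  and space_radon: "space radon = topspace X"
proof -
  have "sigma_sets (topspace X) {U. openin X U} \<subseteq> Pow (topspace X)"
    using sigma_sets_into_sp[OF opens_Pow] by blast
  then show "sets radon = sigma_sets (topspace X) {U. openin X U}" "space radon = topspace X"
    unfolding radon_def by (simp_all add: space_measure_of sigma_sets_sigma_sets_eq[OF opens_Pow])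
qed

lemma emeasure_radon:
  assumes B: "B \<in> sets radon"
  shows "emeasure radon B = outer_charge B"
proof -
  interpret Pow: sigma_algebra "topspace X" "Pow (topspace X)"
    by (rule sigma_algebra_Pow)
  define \<L> where "\<L> = lambda_system (topspace X) (Pow (topspace X)) outer_charge"
  have ms: "measure_space (topspace X) \<L> outer_charge"
    unfolding \<L>_def by (rule Pow.caratheodory_lemma[OF outer_measure_space_outer])
  have "{U. openin X U} \<subseteq> \<L>"
  proof safe
    fix V assume V: "openin X V"
    have "outer_charge (E \<inter> V) + outer_charge (E - V) = outer_charge E" if "E \<subseteq> topspace X" for E
    proof (rule antisym)
      have "outer_charge E = outer_charge ((E \<inter> V) \<union> (E - V))"
        by (simp add: Int_Diff_Un)
      also have "\<dots> \<le> outer_charge (E \<inter> V) + outer_charge (E - V)"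
        using that by (intro outer_Un_le) auto
      finally show "outer_charge E \<le> outer_charge (E \<inter> V) + outer_charge (E - V)" .
    qed (rule outer_open_split[OF V that])
    then show "V \<in> \<L>"
      unfolding \<L>_def Pow.lambda_system_eq using openin_subset[OF V] by auto
  qed
  then have sub: "sigma_sets (topspace X) {U. openin X U} \<subseteq> \<L>"
    using ms by (auto simp: measure_space_def intro: sigma_algebra.sigma_sets_subset[THEN subsetD])
  have "measure_space (topspace X) (sigma_sets (topspace X) {U. openin X U}) outer_charge"
    using measure_down[OF ms sigma_algebra_sigma_sets[OF opens_Pow] sub] .
  then show ?thesis
    unfolding radon_def using B
    by (intro emeasure_measure_of_sigma) (auto simp: measure_space_def sets_radon)
qed

lemma open_in_sets_radon: "openin X U \<Longrightarrow> U \<in> sets radon"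
  by (simp add: sets_radon)

lemma compact_in_sets_radon: "compactin X C \<Longrightarrow> C \<in> sets radon"
proof -
  assume C: "compactin X C"
  then have "openin X (topspace X - C)"
    using compactin_imp_closedin[OF hausdorff] by blast
  then have "space radon - (topspace X - C) \<in> sets radon"
    using open_in_sets_radon by blast
  moreover have "space radon - (topspace X - C) = C"
    using compactin_subset_topspace[OF C] by (auto simp: space_radon)
  ultimately show ?thesis by simp
qed

lemma finite_measure_radon: "finite_measure radon"
proof
  show "emeasure radon (space radon) \<noteq> \<infinity>"
    using outer_finite[of "topspace X"] emeasure_radon[OF sets.top[of radon]] by (simp add: space_radon)
qed

text \<open>
  On open sets the measure is at most the charge, and on compact sets at least. The former bounds
  integrals from above; the latter, applied to \<open>K\<close>, gives the total mass.
\<close>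

lemma emeasure_radon_open_le: "openin X U \<Longrightarrow> emeasure radon U \<le> c U"
  using emeasure_radon[OF open_in_sets_radon] outer_open inner_le_charge by metis

lemma charge_le_emeasure_radon: "compactin X C \<Longrightarrow> c C \<le> emeasure radon C"
  unfolding emeasure_radon[OF compact_in_sets_radon] outer_charge_def
  by (rule INF_greatest) (auto intro: charge_le_inner)

lemma emeasure_radon_outside: "emeasure radon (topspace X - K) = 0"
proof -
  have "openin X (topspace X - K)"
    using compactin_imp_closedin[OF hausdorff compact_K] by blast
  then have "emeasure radon (topspace X - K) \<le> c (topspace X - K)"
    by (rule emeasure_radon_open_le)
  also have "\<dots> \<le> c {}"
    by (rule charge_mono) auto
  finally show ?thesis by simp
qed

lemma emeasure_radon_space: "emeasure radon (topspace X) = c UNIV"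
proof (rule antisym)
  show "emeasure radon (topspace X) \<le> c UNIV"
    using emeasure_radon_open_le[OF openin_topspace] charge_mono[of "topspace X" UNIV] by (auto intro: order_trans)
  have "c UNIV \<le> c K"
    by (rule charge_mono) auto
  also have "\<dots> \<le> emeasure radon K"
    by (rule charge_le_emeasure_radon[OF compact_K])
  also have "\<dots> \<le> emeasure radon (topspace X)"
    using compactin_subset_topspace[OF compact_K] open_in_sets_radon by (intro emeasure_mono) auto
  finally show "c UNIV \<le> emeasure radon (topspace X)" .
qed

text \<open>
  An open set slightly larger than the complement of \<open>B\<close> leaves out a compact subset of \<open>K\<close> that is almost
  all of \<open>B\<close>, since the complement of \<open>K\<close> is a null set.
\<close>

lemma radon_compact_approx:
  assumes B: "B \<in> sets radon" and e: "0 < e"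
  shows "\<exists>C. compactin X C \<and> C \<subseteq> B \<and> emeasure radon B \<le> emeasure radon C + ennreal e"
proof -
  interpret finite_measure radon by (rule finite_measure_radon)
  have BX: "B \<subseteq> topspace X"
    using sets.sets_into_space[OF B] by (simp add: space_radon)
  have BcM: "topspace X - B \<in> sets radon"
    using sets.compl_sets[OF B] by (simp add: space_radon)
  have "outer_charge (topspace X - B) < outer_charge (topspace X - B) + ennreal e"
    using e outer_finite[of "topspace X - B"] by (simp add: less_top)
  then obtain U where U: "openin X U" "topspace X - B \<subseteq> U" "inner_charge U < outer_charge (topspace X - B) + ennreal e"
    by (subst (asm) (1) outer_charge_def) (auto simp: INF_less_iff)
  define C where "C = K - U"
  have C: "compactin X C"
    using closed_compactin[OF compact_K, of C] compactin_imp_closedin[OF hausdorff compact_K] U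
    by (simp add: C_def closedin_diff)
  have UM: "U \<in> sets radon" by (rule open_in_sets_radon[OF U(1)])
  have "U = (B \<inter> U) \<union> (topspace X - B)"
    using U openin_subset[OF U(1)] by auto
  then have "emeasure radon U = emeasure radon (B \<inter> U) + emeasure radon (topspace X - B)"
    using plus_emeasure[of "B \<inter> U" radon "topspace X - B"] B BcM UM
    by (metis Diff_disjoint Int_assoc inf_bot_right inf_commute sets.Int)
  moreover have "emeasure radon U \<le> emeasure radon (topspace X - B) + ennreal e"
    using U UM BcM by (simp add: emeasure_radon outer_open less_imp_le)
  ultimately have small: "emeasure radon (B \<inter> U) \<le> ennreal e"
    using e by (simp add: emeasure_eq_measure flip: ennreal_plus)
  have "emeasure radon B \<le> emeasure radon (C \<union> ((B \<inter> U) \<union> (topspace X - K)))"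
    using BX B UM compact_in_sets_radon[OF C] compact_in_sets_radon[OF compact_K] open_in_sets_radon[OF openin_topspace]
    by (intro emeasure_mono) (auto simp: C_def)
  also have "\<dots> \<le> emeasure radon C + (emeasure radon (B \<inter> U) + emeasure radon (topspace X - K))"
    using B UM compact_in_sets_radon[OF C] compact_in_sets_radon[OF compact_K] open_in_sets_radon[OF openin_topspace]
    by (intro order_trans[OF emeasure_subadditive] add_mono order_refl) auto
  also have "\<dots> \<le> emeasure radon C + ennreal e"
    using small by (simp add: emeasure_radon_outside)
  finally show ?thesis
    using C U compactin_subset_topspace[OF compact_K] by (intro exI[of _ C]) (auto simp: C_def)
qed

theorem radon_measure_on_radon: "radon_measure_on X radon"
  unfolding radon_measure_on_def
proof (intro conjI ballI)
  interpret finite_measure radon by (rule finite_measure_radon)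
  show "space radon = topspace X" "sets radon = sigma_sets (topspace X) {U. openin X U}"
    by (fact space_radon sets_radon)+
  show "\<exists>U. openin X U \<and> x \<in> U \<and> emeasure radon U < \<infinity>" if "x \<in> topspace X" for x
    using that by (intro exI[of _ "topspace X"]) (simp add: emeasure_eq_measure)
  show "emeasure radon B = (SUP C\<in>{C. compactin X C \<and> C \<subseteq> B}. emeasure radon C)"
    if B: "B \<in> sets radon" for B
  proof (rule antisym)
    show "emeasure radon B \<le> (SUP C\<in>{C. compactin X C \<and> C \<subseteq> B}. emeasure radon C)"
    proof (rule ennreal_le_epsilon)
      fix e :: real assume "0 < e"
      then obtain C where C: "compactin X C" "C \<subseteq> B" "emeasure radon B \<le> emeasure radon C + ennreal e"
        using radon_compact_approx[OF B] by blast
      have "emeasure radon C \<le> (SUP C\<in>{C. compactin X C \<and> C \<subseteq> B}. emeasure radon C)"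
        using C by (intro SUP_upper) auto
      with C(3) show "emeasure radon B \<le> (SUP C\<in>{C. compactin X C \<and> C \<subseteq> B}. emeasure radon C) + ennreal e"
        by (meson add_right_mono order_trans)
    qed
  qed (auto intro!: SUP_least emeasure_mono B)
qed

end

section \<open>Integration against the Radon measure of a positive functional\<close>

text \<open>
  The number of integers \<open>k\<close> with \<open>1 \<le> k < s\<close> differs from \<open>s\<close> by at most \<open>1\<close>. With \<open>s = n g x\<close> this approximates
  a function \<open>g\<close> with values in the unit interval by the average of the indicators of \<open>n\<close> of its
  superlevel sets, up to \<open>1 / n\<close>.
\<close>

lemma count_levels:
  fixes s :: real
  assumes "0 \<le> s"
  shows "(\<Sum>k=1..m. indicator {real k<..} s) \<le> s"
    and "s \<le> real m \<Longrightarrow> s \<le> (\<Sum>k=1..m. indicator {real k<..} s) + 1"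
proof -
  define N where "N m = (\<Sum>k=1..m. indicator {real k<..} s :: real)" for m
  have N_0: "N 0 = 0" and N_Suc: "N (Suc m) = N m + indicator {real (Suc m)<..} s" for m
    by (simp_all add: N_def)
  have "N m \<le> s \<and> N m \<le> real m \<and> (real m < s \<longrightarrow> N m = real m) \<and> (s \<le> N m + 1 \<or> real m + 1 < s)"
  proof (induction m)
    case 0
    then show ?case using assms by (auto simp: N_0)
  next
    case (Suc m)
    then show ?case
      by (cases "real (Suc m) < s") (auto simp: N_Suc)
  qed
  then show "(\<Sum>k=1..m. indicator {real k<..} s) \<le> s"
    and "s \<le> real m \<Longrightarrow> s \<le> (\<Sum>k=1..m. indicator {real k<..} s) + 1"
    by (auto simp: N_def)
qed

context
  fixes K :: "'b set" and \<Phi> :: "('b \<Rightarrow> real) \<Rightarrow> real"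
  assumes \<Phi>: "positive_functional_on K \<Phi>"
begin

lemma functional_add: "bounded (f ` K) \<Longrightarrow> bounded (g ` K) \<Longrightarrow> \<Phi> (\<lambda>x. f x + g x) = \<Phi> f + \<Phi> g"
  and functional_scale: "bounded (f ` K) \<Longrightarrow> \<Phi> (\<lambda>x. c * f x) = c * \<Phi> f"
  and functional_mono: "bounded (f ` K) \<Longrightarrow> bounded (g ` K) \<Longrightarrow> (\<And>x. x \<in> K \<Longrightarrow> f x \<le> g x) \<Longrightarrow> \<Phi> f \<le> \<Phi> g"
  using \<Phi> by (auto simp: positive_functional_on_def)

lemma functional_0: "\<Phi> (\<lambda>x. 0) = 0"
  using functional_scale[of "\<lambda>x. 0" 0] by (simp add: image_constant_conv)

lemma functional_const: "\<Phi> (\<lambda>x. c) = c * \<Phi> (\<lambda>x. 1)"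
  using functional_scale[of "\<lambda>x. 1" c] by (simp add: image_constant_conv)

lemma bounded_indicator: "bounded ((indicator E :: 'b \<Rightarrow> real) ` A)"
  by (rule boundedI[of _ 1]) (auto simp: indicator_def)

lemma functional_nonneg: "bounded (f ` K) \<Longrightarrow> (\<And>x. x \<in> K \<Longrightarrow> 0 \<le> f x) \<Longrightarrow> 0 \<le> \<Phi> f"
  using functional_mono[of "\<lambda>x. 0" f] by (simp add: functional_0 image_constant_conv)

lemma functional_sum:
  assumes "finite I" "\<And>i. i \<in> I \<Longrightarrow> bounded (f i ` K)"
  shows "bounded ((\<lambda>x. \<Sum>i\<in>I. f i x) ` K) \<and> \<Phi> (\<lambda>x. \<Sum>i\<in>I. f i x) = (\<Sum>i\<in>I. \<Phi> (f i))"
  using assms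
proof (induction I rule: finite_induct)
  case empty
  then show ?case by (simp add: functional_0 image_constant_conv)
next
  case (insert i I)
  then have "bounded ((\<lambda>x. \<Sum>i\<in>I. f i x) ` K)" "\<Phi> (\<lambda>x. \<Sum>i\<in>I. f i x) = (\<Sum>i\<in>I. \<Phi> (f i))" "bounded (f i ` K)"
    by auto
  with insert.hyps show ?case
    by (simp add: functional_add bounded_plus_comp)
qed

lemma functional_charge:
  assumes "Hausdorff_space X" "compactin X K"
  shows "charge_on_compact X K (\<lambda>E. ennreal (\<Phi> (indicator E)))"
proof
  fix E F :: "'b set"
  show "ennreal (\<Phi> (indicator E)) \<le> ennreal (\<Phi> (indicator F))" if "E \<inter> K \<subseteq> F"
    using that by (intro ennreal_leI functional_mono bounded_indicator) (auto simp: indicator_def)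
  show "ennreal (\<Phi> (indicator (E \<union> F))) = ennreal (\<Phi> (indicator E)) + ennreal (\<Phi> (indicator F))"
    if "E \<inter> F = {}"
  proof -
    have "indicator (E \<union> F) = (\<lambda>x. indicator E x + indicator F x :: real)"
      using that by (auto simp: indicator_def fun_eq_iff)
    then have "\<Phi> (indicator (E \<union> F)) = \<Phi> (indicator E) + \<Phi> (indicator F)"
      by (simp add: functional_add bounded_indicator)
    then show ?thesis
      by (simp add: functional_nonneg bounded_indicator ennreal_plus)
  qed
qed (use assms in auto)

text \<open>
  It is enough to show \<open>\<integral> f \<le> \<Phi> f\<close>, as the same holds for \<open>- f\<close>. After an affine change \<open>f\<close> has values in the
  unit interval on \<open>K\<close>. Up to \<open>1 / n\<close> it is then an average of indicators of open superlevel sets, whose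
  measure is at most their value under \<open>\<Phi>\<close>.
\<close>

theorem radon_measure_of_positive_functional:
  assumes X: "Hausdorff_space X" and K: "compactin X K"
  shows "\<exists>\<mu>. radon_measure_on X \<mu> \<and> emeasure \<mu> (topspace X - K) = 0 \<and>
    (\<forall>f. continuous_map X euclideanreal f \<longrightarrow> integrable \<mu> f \<and> (\<integral>x. f x \<partial>\<mu>) = \<Phi> f)"
proof -
  interpret charge_on_compact X K "\<lambda>E. ennreal (\<Phi> (indicator E))"
    using functional_charge[OF X K] .
  interpret finite_measure radon by (rule finite_measure_radon)
  have AE_K: "AE x in radon. x \<in> K"
  proof (rule AE_I')
    show "topspace X - K \<in> null_sets radon"
      using emeasure_radon_outside open_in_sets_radon compactin_imp_closedin[OF X K] by blast
  qed (auto simp: space_radon)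
  have total: "measure radon (space radon) = \<Phi> (\<lambda>x. 1)"
  proof -
    have "emeasure radon (space radon) = ennreal (\<Phi> (\<lambda>x. 1))"
      using emeasure_radon_space by (simp add: space_radon indicator_UNIV[abs_def])
    moreover have "0 \<le> \<Phi> (\<lambda>x. 1)"
      by (intro functional_nonneg) (simp_all add: image_constant_conv)
    ultimately show ?thesis
      by (simp add: measure_def)
  qed
  have measure_open: "measure radon U \<le> \<Phi> (indicator U)" if "openin X U" for U
    using emeasure_radon_open_le[OF that]
    by (simp add: emeasure_eq_measure functional_nonneg bounded_indicator)
  have meas: "f \<in> borel_measurable radon" if f: "continuous_map X euclideanreal f" for f
  proof (rule borel_measurableI)
    fix S :: "real set" assume "open S"
    then have "openin X {x \<in> topspace X. f x \<in> S}"
      using f by (simp add: openin_continuous_map_preimage)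
    moreover have "f -` S \<inter> space radon = {x \<in> topspace X. f x \<in> S}"
      by (auto simp: space_radon)
    ultimately show "f -` S \<inter> space radon \<in> sets radon"
      by (simp add: open_in_sets_radon)
  qed
  have bdd: "bounded (f ` K)" if f: "continuous_map X euclideanreal f" for f
    using image_compactin[OF K f] by (simp add: compact_imp_bounded)
  have int: "integrable radon f" if f: "continuous_map X euclideanreal f" for f
  proof -
    obtain B where "\<forall>x\<in>K. norm (f x) \<le> B"
      using bdd[OF f] by (auto simp: bounded_iff)
    then show ?thesis
      using AE_K by (intro integrable_const_bound[of _ B] meas f) auto
  qed
  have unit: "(\<integral>x. g x \<partial>radon) \<le> \<Phi> g"
    if g: "continuous_map X euclideanreal g" and g01: "\<And>x. x \<in> K \<Longrightarrow> 0 \<le> g x \<and> g x \<le> 1" for g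
  proof -
    have bound: "(\<integral>x. g x \<partial>radon) \<le> \<Phi> g + \<Phi> (\<lambda>x. 1) / real (Suc m)" for m
    proof -
      define n where "n = Suc m"
      have n: "0 < real n" by (simp add: n_def)
      define U where "U k = {x \<in> topspace X. real k < real n * g x}" for k
      have U: "openin X (U k)" for k
      proof -
        have "openin X {x \<in> topspace X. g x \<in> {real k / real n<..}}"
          using g by (intro openin_continuous_map_preimage) auto
        moreover have "U k = {x \<in> topspace X. g x \<in> {real k / real n<..}}"
          using n by (auto simp: U_def field_simps)
        ultimately show ?thesis by simp
      qed
      define h where "h x = (\<Sum>k=1..n. indicator (U k) x :: real)" for x
      have h_int: "integrable radon h"
        unfolding h_def using U open_in_sets_radon
        by (intro Bochner_Integration.integrable_sum integrable_real_indicator) (auto simp: emeasure_eq_measure)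
      have h_sum: "h x = (\<Sum>k=1..n. indicator {real k<..} (real n * g x))" if "x \<in> K" for x
        unfolding h_def using that compactin_subset_topspace[OF K]
        by (intro sum.cong) (auto simp: U_def indicator_def)
      have h_le: "h x \<le> real n * g x" and h_ge: "real n * g x \<le> h x + 1" if "x \<in> K" for x
        unfolding h_sum[OF that] using g01[OF that] n
        by (intro count_levels; simp add: mult_left_le)+
      have hb: "bounded (h ` K)" and h_functional: "\<Phi> h = (\<Sum>k=1..n. \<Phi> (indicator (U k)))"
        unfolding h_def using functional_sum[of "{1..n}" "\<lambda>k. indicator (U k)"] bounded_indicator by auto
      have "real n * (\<integral>x. g x \<partial>radon) = (\<integral>x. real n * g x \<partial>radon)"
        by simp
      also have "\<dots> \<le> (\<integral>x. h x + 1 \<partial>radon)"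
        using AE_K h_ge h_int int[OF g] by (intro integral_mono_AE) auto
      also have "\<dots> = (\<Sum>k=1..n. measure radon (U k)) + measure radon (space radon)"
      proof -
        have "(\<integral>x. h x \<partial>radon) = (\<Sum>k=1..n. measure radon (U k))"
          unfolding h_def using U open_in_sets_radon
          by (subst Bochner_Integration.integral_sum)
            (auto intro!: sum.cong integrable_real_indicator simp: emeasure_eq_measure)
        then show ?thesis
          using h_int by simp
      qed
      also have "\<dots> \<le> \<Phi> h + \<Phi> (\<lambda>x. 1)"
        unfolding h_functional total using U measure_open by (intro add_mono sum_mono) auto
      also have "\<Phi> h \<le> \<Phi> (\<lambda>x. real n * g x)"
        using hb h_le bounded_scaleR_comp[OF bdd[OF g], of "real n"] by (intro functional_mono) auto
      also have "\<dots> = real n * \<Phi> g"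
        by (rule functional_scale[OF bdd[OF g]])
      finally have "real n * (\<integral>x. g x \<partial>radon) \<le> real n * \<Phi> g + \<Phi> (\<lambda>x. 1)"
        by simp
      then show ?thesis
        using n unfolding n_def by (simp add: field_simps)
    qed
    have "(\<lambda>m. \<Phi> g + \<Phi> (\<lambda>x. 1) * inverse (real (Suc m))) \<longlonglongrightarrow> \<Phi> g + \<Phi> (\<lambda>x. 1) * 0"
      by (intro tendsto_intros LIMSEQ_inverse_real_of_nat)
    then show ?thesis
      using bound by (intro LIMSEQ_le_const) (auto simp: divide_inverse)
  qed
  have upper: "(\<integral>x. f x \<partial>radon) \<le> \<Phi> f" if f: "continuous_map X euclideanreal f" for f
  proof -
    obtain B where "0 < B" and B: "\<And>x. x \<in> K \<Longrightarrow> \<bar>f x\<bar> \<le> B"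
      using bdd[OF f] by (auto simp: bounded_pos)
    define g where "g x = (f x + B) / (2 * B)" for x
    have g: "continuous_map X euclideanreal g"
      unfolding g_def using f \<open>0 < B\<close> by (intro continuous_intros) auto
    have f_eq: "f x = 2 * B * g x + - B" for x
      using \<open>0 < B\<close> by (simp add: g_def field_simps)
    have "(\<integral>x. g x \<partial>radon) \<le> \<Phi> g"
    proof (rule unit[OF g])
      fix x assume "x \<in> K"
      then show "0 \<le> g x \<and> g x \<le> 1"
        using B[of x] \<open>0 < B\<close> by (auto simp: g_def field_simps abs_le_iff)
    qed
    then have "2 * B * (\<integral>x. g x \<partial>radon) - B * \<Phi> (\<lambda>x. 1) \<le> 2 * B * \<Phi> g - B * \<Phi> (\<lambda>x. 1)"
      using \<open>0 < B\<close> by simp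
    also have "\<dots> = \<Phi> f"
      unfolding f_eq using functional_add[of "\<lambda>x. 2 * B * g x" "\<lambda>x. - B"] functional_scale[OF bdd[OF g]]
        bounded_scaleR_comp[OF bdd[OF g], of "2 * B"] functional_const[of "- B"]
      by (simp add: image_constant_conv)
    also have "2 * B * (\<integral>x. g x \<partial>radon) - B * \<Phi> (\<lambda>x. 1) = (\<integral>x. f x \<partial>radon)"
      unfolding f_eq using int[OF g] total by simp
    finally show ?thesis .
  qed
  have "(\<integral>x. f x \<partial>radon) = \<Phi> f" if f: "continuous_map X euclideanreal f" for f
  proof (rule antisym[OF upper[OF f]])
    have "(\<integral>x. - f x \<partial>radon) \<le> \<Phi> (\<lambda>x. - f x)"
      using f by (intro upper continuous_intros)
    also have "\<Phi> (\<lambda>x. - f x) = - \<Phi> f"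
      using functional_scale[OF bdd[OF f], of "- 1"] by simp
    finally show "\<Phi> f \<le> (\<integral>x. f x \<partial>radon)"
      by simp
  qed
  then show ?thesis
    using radon_measure_on_radon emeasure_radon_outside int by (intro exI[of _ radon]) blast
qed

end

section \<open>Separation in function spaces\<close>

text \<open>
  Different functions are separated in a coordinate where they differ. Through the Hausdorff instance,
  which comes with its two superclasses, the Stone-Weierstrass theorem becomes applicable to compact sets
  of characters.
\<close>

lemma open_coordinate_preimage:
  fixes U :: "'b::topological_space set"
  assumes "open U"
  shows "open {h :: 'a \<Rightarrow> 'b. h a \<in> U}"
  using open_vimage[OF assms continuous_on_product_coordinates[of a]] by (simp add: vimage_def)

instance "fun" :: (type, t0_space) t0_space
proof
  fix f g :: "'a \<Rightarrow> 'b"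
  assume "f \<noteq> g"
  then obtain a where a: "f a \<noteq> g a" by auto
  obtain U where "open U" "\<not> (f a \<in> U \<longleftrightarrow> g a \<in> U)"
    using iffD1[OF separation_t0 a] by blast
  then show "\<exists>U. open U \<and> \<not> (f \<in> U \<longleftrightarrow> g \<in> U)"
    by (intro exI[of _ "{h. h a \<in> U}"]) (simp add: open_coordinate_preimage)
qed

instance "fun" :: (type, t1_space) t1_space
proof
  fix f g :: "'a \<Rightarrow> 'b"
  assume "f \<noteq> g"
  then obtain a where a: "f a \<noteq> g a" by auto
  obtain U where "open U" "f a \<in> U" "g a \<notin> U"
    using iffD1[OF separation_t1 a] by blast
  then show "\<exists>U. open U \<and> f \<in> U \<and> g \<notin> U"
    by (intro exI[of _ "{h. h a \<in> U}"]) (simp add: open_coordinate_preimage)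
qed

instance "fun" :: (type, t2_space) t2_space
proof
  fix f g :: "'a \<Rightarrow> 'b"
  assume "f \<noteq> g"
  then obtain a where a: "f a \<noteq> g a" by auto
  obtain U V where "open U" "open V" "f a \<in> U" "g a \<in> V" "U \<inter> V = {}"
    using iffD1[OF separation_t2 a] by blast
  then show "\<exists>U V. open U \<and> open V \<and> f \<in> U \<and> g \<in> V \<and> U \<inter> V = {}"
    by (intro exI[of _ "{h. h a \<in> U}"] exI[of _ "{h. h a \<in> V}"]) (auto simp: open_coordinate_preimage)
qed

section \<open>The space of characters\<close>

lemma topspace_char_space [simp]: "topspace char_space = characters"
  by (simp add: char_space_def euclidean_product_topology)

lemma char_space_euclidean: "char_space = subtopology euclidean characters"
  by (simp add: char_space_def euclidean_product_topology)

lemma compactin_char_space: "compactin char_space S \<longleftrightarrow> compact S \<and> S \<subseteq> characters"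
  by (simp add: char_space_euclidean compactin_subtopology compactin_euclidean_iff)

lemma Hausdorff_char_space: "Hausdorff_space char_space"
  unfolding char_space_def
  by (intro Hausdorff_space_subtopology) (simp add: Hausdorff_space_product_topology)

lemma continuous_map_evaluation: "continuous_map char_space euclideanreal (\<lambda>\<alpha>. \<alpha> a)"
  unfolding char_space_euclidean
  by (intro continuous_map_from_subtopology) simp

lemma openin_evaluation_preimage: "open U \<Longrightarrow> openin char_space {\<alpha> \<in> characters. \<alpha> a \<in> U}"
  using openin_continuous_map_preimage[OF continuous_map_evaluation, of U a] by simp

lemma
  assumes "\<alpha> \<in> characters"
  shows character_linear: "linear \<alpha>"
    and character_mult: "\<alpha> (a * b) = \<alpha> a * \<alpha> b"
    and character_1: "\<alpha> 1 = 1"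
  using assms by (auto simp: characters_def)

lemma character_of_real: "\<alpha> \<in> characters \<Longrightarrow> \<alpha> (of_real r) = r"
  by (simp add: of_real_def linear_scale character_linear character_1)

lemma character_power: "\<alpha> \<in> characters \<Longrightarrow> \<alpha> (a ^ n) = \<alpha> a ^ n"
  by (induction n) (simp_all add: character_mult character_1)

lemma character_prod: "\<alpha> \<in> characters \<Longrightarrow> \<alpha> (prod f I) = (\<Prod>i\<in>I. \<alpha> (f i))"
  by (induction I rule: infinite_finite_induct) (simp_all add: character_mult character_1)

lemma closed_characters: "closed (characters :: ('a::{real_algebra_1,comm_ring_1} \<Rightarrow> real) set)"
proof -
  have "characters = (\<Inter>a. \<Inter>b. {\<alpha> :: 'a \<Rightarrow> real. \<alpha> (a + b) = \<alpha> a + \<alpha> b}) \<inter>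
      (\<Inter>r. \<Inter>a. {\<alpha>. \<alpha> (r *\<^sub>R a) = r * \<alpha> a}) \<inter>
      (\<Inter>a. \<Inter>b. {\<alpha>. \<alpha> (a * b) = \<alpha> a * \<alpha> b}) \<inter> {\<alpha>. \<alpha> 1 = 1}"
    by (auto simp: characters_def linear_iff)
  moreover have "closed \<dots>"
    by (intro closed_Int closed_INT ballI closed_Collect_eq continuous_intros
      continuous_on_product_coordinates)
  ultimately show ?thesis by simp
qed

definition character_box :: "('a::{real_algebra_1,comm_ring_1} \<Rightarrow> real) \<Rightarrow> ('a \<Rightarrow> real) set" where
  "character_box c = {\<alpha> \<in> characters. \<forall>a. \<bar>\<alpha> a\<bar> \<le> c a}"

text \<open>
  By Tychonoff's theorem, as a closed subset of a product of compact intervals.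
\<close>

lemma compactin_character_box: "compactin char_space (character_box c)"
proof -
  have "compactin (powertop_real UNIV) (\<Pi>\<^sub>E a\<in>UNIV. {- c a..c a})"
    by (simp add: compactin_PiE)
  then have "compact (\<Pi>\<^sub>E a\<in>UNIV. {- c a..c a})"
    by (simp add: euclidean_product_topology)
  moreover have "character_box c = (\<Pi>\<^sub>E a\<in>UNIV. {- c a..c a}) \<inter> characters"
    by (auto simp: character_box_def abs_le_iff minus_le_iff PiE_iff)
  ultimately show ?thesis
    using closed_characters by (auto simp: compactin_char_space intro: compact_Int_closed)
qed

section \<open>Functionals nonnegative on products\<close>

text \<open>
  The preprime generated by the elements \<open>c a - a\<close> and \<open>c a + a\<close>. Products are built by appending one factor
  at a time, which matches the product hypothesis on \<open>L\<close>.
\<close>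

inductive_set product_cone :: "('a::{real_algebra_1,comm_ring_1} \<Rightarrow> real) \<Rightarrow> 'a set"
  for c where
    const: "0 \<le> r \<Longrightarrow> of_real r \<in> product_cone c"
  | factor: "x \<in> product_cone c \<Longrightarrow> j \<in> {1, 2} \<Longrightarrow> x * signed_factor c j a \<in> product_cone c"
  | add: "x \<in> product_cone c \<Longrightarrow> y \<in> product_cone c \<Longrightarrow> x + y \<in> product_cone c"

lemma product_cone_scale:
  assumes "x \<in> product_cone c" "0 \<le> r"
  shows "x * of_real r \<in> product_cone c"
  using assms(1)
proof induction
  case (const s)
  then show ?case
    using product_cone.const[of "s * r"] assms(2) by simp
next
  case (factor x j a)
  then show ?case
    using product_cone.factor[OF factor.IH factor.hyps(2)] by (simp add: ac_simps)
next
  case (add x y)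
  then show ?case
    by (simp add: distrib_right product_cone.add)
qed

lemma product_cone_mult:
  assumes "x \<in> product_cone c" "y \<in> product_cone c"
  shows "x * y \<in> product_cone c"
  using assms(2)
proof induction
  case (const r)
  then show ?case
    by (rule product_cone_scale[OF assms(1)])
next
  case (factor y j a)
  then show ?case
    using product_cone.factor[OF factor.IH factor.hyps(2)] by (simp add: mult.assoc)
next
  case (add y z)
  then show ?case
    by (simp add: distrib_left product_cone.add)
qed

lemma signed_factor_mem_product_cone: "j \<in> {1, 2} \<Longrightarrow> signed_factor c j a \<in> product_cone c"
  using product_cone.factor[OF product_cone.const[of 1], of j c a] by simp

lemma archimedean_product_cone: "archimedean_preprime (product_cone c)"
proof
  fix x
  have "(of_real (c x) - x) + of_real (max 0 (c x) - c x) \<in> product_cone c"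
    using signed_factor_mem_product_cone[of 1 c x]
    by (intro product_cone.intros) (auto simp: signed_factor_def)
  moreover have "(of_real (c x) - x) + of_real (max 0 (c x) - c x) = of_real (max 0 (c x)) - x"
    by simp
  ultimately show "\<exists>N\<ge>0. of_real N - x \<in> product_cone c"
    by (metis max.cobounded1)
qed (auto intro: product_cone.intros product_cone_mult)

lemma nonneg_on_products_list:
  assumes L: "nonneg_on_products L c" "0 \<le> L 1"
    and xs: "fst ` set xs \<subseteq> {1, 2}"
  shows "0 \<le> L (prod_list (map (\<lambda>(j, a). signed_factor c j a) xs))"
proof (cases "xs = []")
  case False
  define n where "n = length xs"
  have "prod_list (map (\<lambda>(j, a). signed_factor c j a) xs)
      = (\<Prod>i\<in>{0..<n}. signed_factor c (fst (xs ! i)) (snd (xs ! i)))"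
    by (simp add: n_def prod.list_conv_set_nth case_prod_unfold)
  also have "\<dots> = (\<Prod>i=1..n. signed_factor c (fst (xs ! (i - 1))) (snd (xs ! (i - 1))))"
    by (rule prod.reindex_bij_witness[of _ "\<lambda>i. i - 1" Suc]) auto
  also have "0 \<le> L \<dots>"
  proof -
    have "fst (xs ! (i - 1)) \<in> {1, 2}" if "i \<in> {1..n}" for i
    proof -
      have "i - 1 < length xs"
        using that by (auto simp: n_def)
      then have "fst (xs ! (i - 1)) \<in> fst ` set xs"
        by (intro imageI nth_mem)
      then show ?thesis
        using xs by blast
    qed
    moreover have "1 \<le> n"
      using False by (simp add: n_def Suc_leI)
    ultimately show ?thesis
      using L(1)[unfolded nonneg_on_products_def, rule_format, of n "\<lambda>i. fst (xs ! (i - 1))" "\<lambda>i. snd (xs ! (i - 1))"]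
      by blast
  qed
  finally show ?thesis .
qed (use L in simp)

text \<open>
  The claim is generalised to \<open>x\<close> times a further product of factors, since appending a factor to \<open>x\<close> moves
  it into that product.
\<close>

lemma nonneg_on_product_cone:
  assumes L: "linear L" "nonneg_on_products L c" "0 \<le> L 1" and x: "x \<in> product_cone c"
  shows "0 \<le> L x"
proof -
  have "0 \<le> L (x * prod_list (map (\<lambda>(j, a). signed_factor c j a) xs))"
    if "fst ` set xs \<subseteq> {1, 2}" for xs
    using x that
  proof (induction arbitrary: xs)
    case (const r)
    have "of_real r * y = r *\<^sub>R y" for y :: 'a
      by (simp add: scaleR_conv_of_real)
    then show ?case
      using nonneg_on_products_list[OF L(2,3) const.prems] const.hyps L(1) by (simp add: linear_scale)
  next
    case (factor x j a)
    then show ?case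
      using factor.IH[of "(j, a) # xs"] by (simp add: mult.assoc)
  next
    case (add x y)
    then show ?case
      using L(1) by (simp add: distrib_right linear_add)
  qed
  from this[of "[]"] show ?thesis by simp
qed

text \<open>
  A character nonnegative on the cone is nonnegative on its generators, so it lies in the box. Hence
  \<open>f + e\<close> is positive at all such characters and belongs to the cone.
\<close>

theorem nonneg_on_box_imp_nonneg:
  assumes L: "linear L" "L 1 = 1" "nonneg_on_products L c"
    and f: "\<And>\<alpha>. \<alpha> \<in> character_box c \<Longrightarrow> 0 \<le> \<alpha> f"
  shows "0 \<le> L f"
proof (rule field_le_epsilon)
  interpret archimedean_preprime "product_cone c"
    by (rule archimedean_product_cone)
  fix e :: real assume e: "0 < e"
  have "f + of_real e \<in> product_cone c"
  proof (rule positive_on_characters_imp_mem)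
    fix \<alpha> :: "'a \<Rightarrow> real" assume \<alpha>: "\<alpha> \<in> characters" "\<forall>p\<in>product_cone c. 0 \<le> \<alpha> p"
    have "\<bar>\<alpha> a\<bar> \<le> c a" for a
    proof -
      have "0 \<le> \<alpha> (signed_factor c 1 a)" "0 \<le> \<alpha> (signed_factor c 2 a)"
        using \<alpha> signed_factor_mem_product_cone[of _ c a] by blast+
      then show ?thesis
        using \<alpha> by (simp add: signed_factor_def linear_add linear_diff character_linear character_of_real abs_le_iff)
    qed
    then have "0 \<le> \<alpha> f"
      using f \<alpha> by (simp add: character_box_def)
    then show "0 < \<alpha> (f + of_real e)"
      using \<alpha> e by (simp add: linear_add character_linear character_of_real)
  qed
  then have "0 \<le> L (f + of_real e)"
    using nonneg_on_product_cone[OF L(1,3)] L(2) by simp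
  then show "0 \<le> L f + e"
    using L by (simp add: linear_add linear_scale of_real_def)
qed

theorem representing_measure_on_box:
  assumes L: "linear L" "L 1 = 1" "nonneg_on_products L c"
  shows "\<exists>\<mu>. representing_measure L \<mu> \<and> emeasure \<mu> (characters - character_box c) = 0"
proof -
  have ch: "\<alpha> \<in> characters" if "\<alpha> \<in> character_box c" for \<alpha>
    using that by (simp add: character_box_def)
  obtain \<Phi> where \<Phi>: "positive_functional_on (character_box c) \<Phi>" "\<And>a. \<Phi> (\<lambda>\<alpha>. \<alpha> a) = L a"
  proof -
    have "\<exists>\<Phi>. positive_functional_on (character_box c) \<Phi> \<and> (\<forall>a. \<Phi> (\<lambda>\<alpha>. \<alpha> a) = L a)"
    proof (rule positive_functional_extension[where u = 1])
      show "linear (\<lambda>a. \<alpha> a)" "\<alpha> 1 = 1" if "\<alpha> \<in> character_box c" for \<alpha> :: "'a \<Rightarrow> real"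
        using ch[OF that] by (simp_all add: character_linear character_1)
      show "bounded ((\<lambda>\<alpha>. \<alpha> a) ` character_box c)" for a
        by (rule boundedI[of _ "c a"]) (auto simp: character_box_def)
      show "0 \<le> L a" if "\<And>\<alpha>. \<alpha> \<in> character_box c \<Longrightarrow> 0 \<le> \<alpha> a" for a
        using nonneg_on_box_imp_nonneg[OF L that] .
    qed (fact L(1))
    then show ?thesis using that by blast
  qed
  then obtain \<mu> where \<mu>: "radon_measure_on char_space \<mu>" "emeasure \<mu> (characters - character_box c) = 0"
    "\<And>f. continuous_map char_space euclideanreal f \<Longrightarrow> integrable \<mu> f \<and> (\<integral>x. f x \<partial>\<mu>) = \<Phi> f"
    using radon_measure_of_positive_functional[OF \<Phi>(1) Hausdorff_char_space compactin_character_box] by auto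
  then show ?thesis
    using \<mu>(3)[OF continuous_map_evaluation] \<Phi>(2) by (auto simp: representing_measure_def)
qed

section \<open>Uniqueness of compactly supported representing measures\<close>

lemma radon_measure_inner_regular:
  assumes "radon_measure_on X \<mu>" "B \<in> sets \<mu>"
  shows "emeasure \<mu> B = (SUP C\<in>{C. compactin X C \<and> C \<subseteq> B}. emeasure \<mu> C)"
  using assms(1)[unfolded radon_measure_on_def, THEN conjunct2, THEN conjunct2, THEN conjunct2] assms(2)
  by (rule bspec)

lemma openin_in_sets_radon: "radon_measure_on X \<mu> \<Longrightarrow> openin X U \<Longrightarrow> U \<in> sets \<mu>"
  by (auto simp: radon_measure_on_def)

lemma closedin_measure_support: "closedin X (measure_support X \<mu>)"
proof -
  have "openin X (topspace X - measure_support X \<mu>)"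
  proof (subst openin_subopen, safe)
    fix x assume "x \<in> topspace X" "x \<notin> measure_support X \<mu>"
    then obtain U where U: "openin X U" "x \<in> U" "emeasure \<mu> U = 0"
      by (auto simp: measure_support_def)
    moreover have "U \<subseteq> topspace X - measure_support X \<mu>"
      using U openin_subset[OF U(1)] by (auto simp: measure_support_def)
    ultimately show "\<exists>T. openin X T \<and> x \<in> T \<and> T \<subseteq> topspace X - measure_support X \<mu>"
      by blast
  qed
  then show ?thesis
    by (auto simp: closedin_def measure_support_def)
qed

lemma measure_support_subset:
  assumes "closedin X C" "emeasure \<mu> (topspace X - C) = 0"
  shows "measure_support X \<mu> \<subseteq> C"
proof
  fix x assume x: "x \<in> measure_support X \<mu>"
  show "x \<in> C"
  proof (rule ccontr)
    assume "x \<notin> C"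
    then have "0 < emeasure \<mu> (topspace X - C)"
      using x assms(1) by (auto simp: measure_support_def closedin_def)
    then show False
      using assms(2) by simp
  qed
qed

text \<open>
  Every compact set disjoint from the support is covered by finitely many open null sets. For
  uncountable covers this would not give a null set, which is why inner regularity enters.
\<close>

lemma emeasure_outside_measure_support:
  assumes \<mu>: "radon_measure_on X \<mu>"
  shows "emeasure \<mu> (topspace X - measure_support X \<mu>) = 0"
proof -
  note open_sets = openin_in_sets_radon[OF \<mu>]
  have "openin X (topspace X - measure_support X \<mu>)"
    using closedin_measure_support by blast
  then have "emeasure \<mu> (topspace X - measure_support X \<mu>)
      = (SUP C\<in>{C. compactin X C \<and> C \<subseteq> topspace X - measure_support X \<mu>}. emeasure \<mu> C)"
    by (rule radon_measure_inner_regular[OF \<mu> open_sets])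
  also have "\<dots> \<le> 0"
  proof (rule SUP_least)
    fix C assume C: "C \<in> {C. compactin X C \<and> C \<subseteq> topspace X - measure_support X \<mu>}"
    define \<U> where "\<U> = {U. openin X U \<and> emeasure \<mu> U = 0}"
    have "C \<subseteq> \<Union>\<U>"
    proof
      fix x assume "x \<in> C"
      then have "x \<in> topspace X" "x \<notin> measure_support X \<mu>"
        using C by auto
      then obtain U where "openin X U" "x \<in> U" "emeasure \<mu> U = 0"
        by (auto simp: measure_support_def)
      then show "x \<in> \<Union>\<U>"
        by (auto simp: \<U>_def)
    qed
    moreover have "\<forall>U\<in>\<U>. openin X U"
      by (simp add: \<U>_def)
    ultimately obtain \<F> where \<F>: "finite \<F>" "\<F> \<subseteq> \<U>" "C \<subseteq> \<Union>\<F>"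
      using C unfolding compactin_def by blast
    have "\<Union>\<F> \<in> null_sets \<mu>"
      using \<F> open_sets by (intro null_sets.finite_Union) (auto simp: \<U>_def)
    then show "emeasure \<mu> C \<le> 0"
      using emeasure_mono[OF \<F>(3), of \<mu>] null_setsD1 null_setsD2 by metis
  qed
  finally show ?thesis by simp
qed

lemma AE_measure_support:
  assumes "radon_measure_on X \<mu>"
  shows "AE x in \<mu>. x \<in> measure_support X \<mu>"
proof (rule AE_I')
  show "topspace X - measure_support X \<mu> \<in> null_sets \<mu>"
    using emeasure_outside_measure_support[OF assms] openin_in_sets_radon[OF assms]
      closedin_measure_support[of X \<mu>] by (intro null_setsI) auto
qed (use assms in \<open>auto simp: radon_measure_on_def\<close>)

lemma compactin_in_sets_radon:
  assumes "radon_measure_on X \<mu>" "Hausdorff_space X" "compactin X C"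
  shows "C \<in> sets \<mu>"
proof -
  have "openin X (topspace X - C)"
    using compactin_imp_closedin[OF assms(2,3)] by blast
  then have "space \<mu> - (topspace X - C) \<in> sets \<mu>"
    using openin_in_sets_radon[OF assms(1)] by (intro sets.compl_sets)
  moreover have "space \<mu> - (topspace X - C) = C"
    using compactin_subset_topspace[OF assms(3)] assms(1) by (auto simp: radon_measure_on_def)
  ultimately show ?thesis by simp
qed

lemma radon_measure_compact_approx:
  assumes \<mu>: "radon_measure_on X \<mu>" "finite_measure \<mu>" and B: "B \<in> sets \<mu>" and e: "0 < e"
  shows "\<exists>D. compactin X D \<and> D \<subseteq> B \<and> measure \<mu> B < measure \<mu> D + e"
proof (rule ccontr)
  interpret finite_measure \<mu> by (rule \<mu>)
  assume "\<not> ?thesis"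
  then have "\<not> measure \<mu> B < measure \<mu> D + e" if "compactin X D" "D \<subseteq> B" for D
    using that by blast
  then have le: "measure \<mu> D \<le> measure \<mu> B - e" if "compactin X D" "D \<subseteq> B" for D
    using that by (simp add: not_less le_diff_eq)
  have "emeasure \<mu> B \<le> ennreal (measure \<mu> B - e)"
    unfolding radon_measure_inner_regular[OF \<mu>(1) B] using le
    by (intro SUP_least) (auto simp: emeasure_eq_measure intro: ennreal_leI)
  moreover have "0 \<le> measure \<mu> B - e"
    using le[of "{}"] by simp
  ultimately show False
    using e by (simp add: emeasure_eq_measure)
qed

lemma prob_space_representing_measure:
  assumes "representing_measure L \<mu>" "L 1 = 1"
  shows "prob_space \<mu>"
proof (rule prob_spaceI)
  have space: "space \<mu> = characters"
    using assms(1) by (simp add: representing_measure_def radon_measure_on_def)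
  have "(\<integral>\<alpha>. \<alpha> 1 \<partial>\<mu>) = (\<integral>\<alpha>. 1 \<partial>\<mu>)"
    by (rule Bochner_Integration.integral_cong) (simp_all add: space character_1)
  then have "measure \<mu> (space \<mu>) = 1"
    using assms by (simp add: representing_measure_def)
  then show "emeasure \<mu> (space \<mu>) = 1"
    by (cases "emeasure \<mu> (space \<mu>)") (auto simp: measure_def)
qed

text \<open>
  Choose a compact \<open>D\<close> in the complement of \<open>C\<close> carrying almost all of its \<open>\<nu>\<close>-mass. By the Stone-Weierstrass
  theorem there is an element \<open>a\<close> whose evaluation has values in the unit interval on both supports, is close
  to \<open>1\<close> on \<open>C\<close> and close to \<open>0\<close> on \<open>D\<close>. Up to multiples of \<open>e\<close> then \<open>\<mu> C \<le> \<integral> \<alpha> a d\<mu> = L a = \<integral> \<alpha> a d\<nu> \<le> \<nu> C\<close>.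
\<close>

lemma compact_measure_le:
  assumes \<mu>: "representing_measure L \<mu>" "compactin char_space (measure_support char_space \<mu>)"
    and \<nu>: "representing_measure L \<nu>" "compactin char_space (measure_support char_space \<nu>)"
    and L: "L 1 = 1" and C: "compactin char_space C"
  shows "measure \<mu> C \<le> measure \<nu> C"
proof -
  interpret \<mu>: prob_space \<mu> by (rule prob_space_representing_measure[OF \<mu>(1) L])
  interpret \<nu>: prob_space \<nu> by (rule prob_space_representing_measure[OF \<nu>(1) L])
  have r: "radon_measure_on char_space \<mu>" "radon_measure_on char_space \<nu>"
    using \<mu> \<nu> by (auto simp: representing_measure_def)
  have space: "space \<mu> = characters" "space \<nu> = characters"
    using r by (auto simp: radon_measure_on_def)
  define S where "S = measure_support char_space \<mu> \<union> measure_support char_space \<nu>"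
  have S: "compact S" "S \<subseteq> characters"
    using \<mu>(2) \<nu>(2) by (auto simp: S_def compactin_char_space)
  have AE_S: "AE \<alpha> in \<mu>. \<alpha> \<in> S" "AE \<alpha> in \<nu>. \<alpha> \<in> S"
    using AE_measure_support[OF r(1)] AE_measure_support[OF r(2)] by (auto simp: S_def)
  define R where "R = {f. \<exists>a. \<forall>\<alpha>\<in>S. f \<alpha> = \<alpha> a}"
  interpret function_ring_on R S
  proof
    show "compact S" by (fact S)
    show "continuous_on S f" if "f \<in> R" for f
    proof -
      obtain a where "\<forall>\<alpha>\<in>S. f \<alpha> = \<alpha> a"
        using \<open>f \<in> R\<close> by (auto simp: R_def)
      moreover have "continuous_on S (\<lambda>\<alpha>. \<alpha> a)"
        by (rule continuous_on_subset[OF continuous_on_product_coordinates]) simp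
      ultimately show ?thesis
        by (simp cong: continuous_on_cong)
    qed
    show "(\<lambda>x. f x + g x) \<in> R" "(\<lambda>x. f x * g x) \<in> R" if fg: "f \<in> R" "g \<in> R" for f g
    proof -
      obtain a b where "\<forall>\<alpha>\<in>S. f \<alpha> = \<alpha> a" "\<forall>\<alpha>\<in>S. g \<alpha> = \<alpha> b"
        using fg by (auto simp: R_def)
      then have "\<forall>\<alpha>\<in>S. f \<alpha> + g \<alpha> = \<alpha> (a + b)" "\<forall>\<alpha>\<in>S. f \<alpha> * g \<alpha> = \<alpha> (a * b)"
        using S by (auto simp: character_mult linear_add character_linear subset_iff)
      then show "(\<lambda>x. f x + g x) \<in> R" "(\<lambda>x. f x * g x) \<in> R"
        unfolding R_def by blast+
    qed
    show "(\<lambda>_. r) \<in> R" for r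
      using S by (auto simp: R_def intro!: exI[of _ "of_real r"] character_of_real[symmetric])
    show "\<exists>f\<in>R. f \<alpha> \<noteq> f \<beta>" if "\<alpha> \<in> S" "\<beta> \<in> S" "\<alpha> \<noteq> \<beta>" for \<alpha> \<beta>
    proof -
      obtain a where "\<alpha> a \<noteq> \<beta> a" using \<open>\<alpha> \<noteq> \<beta>\<close> by auto
      then show ?thesis
        by (intro bexI[of _ "\<lambda>\<gamma>. \<gamma> a"]) (auto simp only: R_def)
    qed
  qed
  have CM: "C \<in> sets \<mu>" "C \<in> sets \<nu>"
    using compactin_in_sets_radon[OF _ Hausdorff_char_space C] r by auto
  have approx: "measure \<mu> C \<le> measure \<nu> C + 3 * e" if e: "0 < e" "e < 1" for e
  proof -
    have "characters - C \<in> sets \<nu>"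
      using sets.compl_sets[OF CM(2)] by (simp add: space)
    then obtain D where D: "compactin char_space D" "D \<subseteq> characters - C"
      and D_e: "measure \<nu> (characters - C) < measure \<nu> D + e"
      using radon_measure_compact_approx[OF r(2) \<nu>.finite_measure_axioms _ e(1)] by blast
    have DM: "D \<in> sets \<nu>"
      using compactin_in_sets_radon[OF r(2) Hausdorff_char_space D(1)] .
    have D_measure: "1 - measure \<nu> C < measure \<nu> D + e"
      using D_e \<nu>.prob_compl[OF CM(2)] by (simp add: space)
    have "closed (D \<inter> S)" "closed (C \<inter> S)"
      using C D(1) S by (auto simp: compactin_char_space compact_imp_closed)
    then obtain f where f: "f \<in> R" "f ` S \<subseteq> {0..1}" "\<forall>\<alpha>\<in>D \<inter> S. f \<alpha> < e" "\<forall>\<alpha>\<in>C \<inter> S. 1 - e < f \<alpha>"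
      using two[of "D \<inter> S" "C \<inter> S" e] D(2) e by blast
    then obtain a where a: "\<And>\<alpha>. \<alpha> \<in> S \<Longrightarrow> f \<alpha> = \<alpha> a"
      by (auto simp: R_def)
    have a_01: "0 \<le> \<alpha> a" "\<alpha> a \<le> 1" if "\<alpha> \<in> S" for \<alpha>
      using f(2) a[OF that] that by auto
    have int: "integrable \<mu> (\<lambda>\<alpha>. \<alpha> a)" "integrable \<nu> (\<lambda>\<alpha>. \<alpha> a)"
      and eq: "(\<integral>\<alpha>. \<alpha> a \<partial>\<mu>) = (\<integral>\<alpha>. \<alpha> a \<partial>\<nu>)"
      using \<mu>(1) \<nu>(1) by (auto simp: representing_measure_def)
    have DcM: "characters - D \<in> sets \<nu>"
      using sets.compl_sets[OF DM] by (simp add: space)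
    have ind: "integrable \<mu> (indicator C :: _ \<Rightarrow> real)" "integrable \<nu> (indicator (characters - D) :: _ \<Rightarrow> real)"
      using CM DcM by (auto intro!: integrable_real_indicator simp: \<mu>.emeasure_eq_measure \<nu>.emeasure_eq_measure)
    have "(1 - e) * measure \<mu> C = (\<integral>\<alpha>. (1 - e) * indicator C \<alpha> \<partial>\<mu>)"
      using CM by simp
    also have "\<dots> \<le> (\<integral>\<alpha>. \<alpha> a \<partial>\<mu>)"
    proof (rule integral_mono_AE)
      show "AE \<alpha> in \<mu>. (1 - e) * indicator C \<alpha> \<le> \<alpha> a"
        using AE_S(1)
      proof eventually_elim
        case (elim \<alpha>)
        then show ?case
          using f(4) a[OF elim] a_01[OF elim] by (force simp: indicator_def)
      qed
    qed (use int ind in auto)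
    also have "\<dots> = (\<integral>\<alpha>. \<alpha> a \<partial>\<nu>)"
      by (rule eq)
    also have "\<dots> \<le> (\<integral>\<alpha>. e + indicator (characters - D) \<alpha> \<partial>\<nu>)"
    proof (rule integral_mono_AE)
      show "AE \<alpha> in \<nu>. \<alpha> a \<le> e + indicator (characters - D) \<alpha>"
        using AE_S(2)
      proof eventually_elim
        case (elim \<alpha>)
        then show ?case
          using f(3) a[OF elim] a_01[OF elim] S e by (force simp: indicator_def)
      qed
      show "integrable \<nu> (\<lambda>\<alpha>. e + indicator (characters - D) \<alpha>)"
        using ind by simp
    qed (fact int)
    also have "\<dots> = e + measure \<nu> (characters - D)"
      using ind DcM \<nu>.prob_space by simp
    also have "\<dots> = e + (1 - measure \<nu> D)"
      using \<nu>.prob_compl[OF DM] by (simp add: space)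
    finally have "(1 - e) * measure \<mu> C \<le> measure \<nu> C + 2 * e"
      using D_measure by simp
    moreover have "e * measure \<mu> C \<le> e"
      using e by (simp add: mult_left_le)
    ultimately show ?thesis
      by (simp add: algebra_simps)
  qed
  show ?thesis
  proof (rule field_le_epsilon)
    fix d :: real assume d: "0 < d"
    \<comment> \<open>the separation argument requires \<open>e < 1\<close>\<close>
    then have "measure \<mu> C \<le> measure \<nu> C + 3 * min (d / 3) (1 / 2)"
      by (intro approx) auto
    then show "measure \<mu> C \<le> measure \<nu> C + d"
      by (simp add: min_def split: if_splits)
  qed
qed

theorem representing_measure_unique:
  assumes \<mu>: "representing_measure L \<mu>" "compactin char_space (measure_support char_space \<mu>)"
    and \<nu>: "representing_measure L \<nu>" "compactin char_space (measure_support char_space \<nu>)"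
    and L: "L 1 = 1"
  shows "\<mu> = \<nu>"
proof (rule measure_eqI)
  interpret \<mu>: prob_space \<mu> by (rule prob_space_representing_measure[OF \<mu>(1) L])
  interpret \<nu>: prob_space \<nu> by (rule prob_space_representing_measure[OF \<nu>(1) L])
  show sets: "sets \<mu> = sets \<nu>"
    using \<mu>(1) \<nu>(1) by (simp add: representing_measure_def radon_measure_on_def)
  fix B assume B: "B \<in> sets \<mu>"
  have "emeasure \<mu> C = emeasure \<nu> C" if "compactin char_space C" for C
    using compact_measure_le[OF \<mu> \<nu> L that] compact_measure_le[OF \<nu> \<mu> L that]
    by (simp add: \<mu>.emeasure_eq_measure \<nu>.emeasure_eq_measure)
  then have sup_eq: "(SUP C\<in>{C. compactin char_space C \<and> C \<subseteq> B}. emeasure \<mu> C)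
      = (SUP C\<in>{C. compactin char_space C \<and> C \<subseteq> B}. emeasure \<nu> C)"
    by (intro SUP_cong) auto
  have r: "radon_measure_on char_space \<mu>" "radon_measure_on char_space \<nu>"
    using \<mu>(1) \<nu>(1) by (simp_all add: representing_measure_def)
  show "emeasure \<mu> B = emeasure \<nu> B"
    using sup_eq radon_measure_inner_regular[OF r(1) B] radon_measure_inner_regular[OF r(2) B[unfolded sets]]
    by (simp only:)
qed

section \<open>Bounds on the support\<close>

lemma C_finite_bounds:
  assumes "C_finite L a"
  defines "C \<equiv> real_of_ereal (C_bound L a)"
  shows "C_bound L a = ereal C" "0 \<le> C" "n \<ge> 1 \<Longrightarrow> L (a ^ (2 * n)) \<le> C ^ (2 * n)"
proof -
  have le: "ereal (root (2 * n) (L (a ^ (2 * n)))) \<le> C_bound L a" if "n \<ge> 1" for n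
    unfolding C_bound_def using that by (intro SUP_upper) auto
  have nonneg: "0 \<le> L (a ^ (2 * n))" if "n \<ge> 1" for n
    using assms that by (simp add: C_finite_def)
  have "0 \<le> root (2 * 1) (L (a ^ (2 * 1)))"
    using nonneg[of 1] by simp
  then have "0 \<le> C_bound L a"
    using le[of 1] by (metis ereal_less_eq(5) order_refl order_trans)
  then show C: "C_bound L a = ereal C" "0 \<le> C"
    using assms by (auto simp: C_finite_def C_def ereal_real real_of_ereal_pos)
  show "L (a ^ (2 * n)) \<le> C ^ (2 * n)" if n: "n \<ge> 1"
  proof -
    have "root (2 * n) (L (a ^ (2 * n))) \<le> C"
      using le[OF n] by (simp add: C)
    then have "root (2 * n) (L (a ^ (2 * n))) ^ (2 * n) \<le> C ^ (2 * n)"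
      using nonneg[OF n] n by (intro power_mono real_root_ge_zero) auto
    then show ?thesis
      using real_root_pow_pos2[of "2 * n" "L (a ^ (2 * n))"] n nonneg[OF n] by simp
  qed
qed

lemma C_finiteI:
  assumes "0 \<le> M" "\<And>n. n \<ge> 1 \<Longrightarrow> 0 \<le> L (a ^ (2 * n))" "\<And>n. n \<ge> 1 \<Longrightarrow> L (a ^ (2 * n)) \<le> M ^ (2 * n)"
  shows "C_finite L a" "C_bound L a \<le> ereal M"
proof -
  show bound: "C_bound L a \<le> ereal M"
    unfolding C_bound_def
  proof (rule SUP_least)
    fix n :: nat assume "n \<in> {1..}"
    then have "root (2 * n) (L (a ^ (2 * n))) \<le> root (2 * n) (M ^ (2 * n))" "0 < 2 * n"
      using assms(3)[of n] by auto
    then show "ereal (root (2 * n) (L (a ^ (2 * n)))) \<le> ereal M"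
      using real_root_power_cancel[of "2 * n" M] assms(1) by simp
  qed
  show "C_finite L a"
    unfolding C_finite_def using assms(2) bound by (auto intro: le_less_trans)
qed

text \<open>
  The key point is \<open>\<bar>\<alpha> a\<bar> \<le> C a\<close> on the support, that is, the supremum norm of an evaluation is bounded by
  its \<open>L\<^bsup>2n\<^esup>\<close> norms. The bound \<open>M\<close> from compactness is only used to see that \<open>C a\<close> is finite.
\<close>

theorem representing_measure_necessary:
  assumes \<mu>: "representing_measure L \<mu>" "compactin char_space (measure_support char_space \<mu>)"
    and L: "L 1 = 1"
  shows "\<forall>a. C_finite L a" "nonneg_on_products L (\<lambda>a. real_of_ereal (C_bound L a))"
proof -
  interpret prob_space \<mu> by (rule prob_space_representing_measure[OF \<mu>(1) L])
  define S where "S = measure_support char_space \<mu>"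
  have r: "radon_measure_on char_space \<mu>"
    and int: "\<And>a. integrable \<mu> (\<lambda>\<alpha>. \<alpha> a)" and L_eq: "\<And>a. L a = (\<integral>\<alpha>. \<alpha> a \<partial>\<mu>)"
    using \<mu>(1) by (auto simp: representing_measure_def)
  have AE_S: "AE \<alpha> in \<mu>. \<alpha> \<in> S"
    unfolding S_def by (rule AE_measure_support[OF r])
  have S: "S \<subseteq> characters" "compact S"
    using \<mu>(2) by (simp_all add: S_def compactin_char_space)
  have L_mono: "L a \<le> L b" if "\<And>\<alpha>. \<alpha> \<in> S \<Longrightarrow> \<alpha> a \<le> \<alpha> b" for a b
    unfolding L_eq using AE_S that by (intro integral_mono_AE int) auto
  have L_nonneg: "0 \<le> L a" if "\<And>\<alpha>. \<alpha> \<in> S \<Longrightarrow> 0 \<le> \<alpha> a" for a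
    unfolding L_eq using AE_S that by (intro integral_nonneg_AE) auto
  have L_real: "L (of_real r) = r" for r
  proof -
    have "L (of_real r) = (\<integral>\<alpha>. r \<partial>\<mu>)"
      unfolding L_eq using r
      by (intro Bochner_Integration.integral_cong) (auto simp: radon_measure_on_def character_of_real)
    then show ?thesis
      using prob_space by simp
  qed
  have finite: "C_finite L a" for a
  proof -
    have "bounded ((\<lambda>\<alpha>. \<alpha> a) ` S)"
      by (intro compact_imp_bounded compact_continuous_image S
        continuous_on_subset[OF continuous_on_product_coordinates]) auto
    then obtain M where M: "0 < M" "\<And>\<alpha>. \<alpha> \<in> S \<Longrightarrow> \<bar>\<alpha> a\<bar> \<le> M"
      by (auto simp: bounded_pos)
    show ?thesis
    proof (rule C_finiteI(1)[of M])
      show "0 \<le> M" using M by simp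
      show "0 \<le> L (a ^ (2 * n))" for n
        using S by (intro L_nonneg) (auto simp: character_power subset_iff)
      have "L (a ^ (2 * n)) \<le> L (of_real (M ^ (2 * n)))" for n
      proof (rule L_mono)
        fix \<alpha> assume \<alpha>: "\<alpha> \<in> S"
        have "\<bar>\<alpha> a\<bar> ^ (2 * n) \<le> M ^ (2 * n)"
          using M \<alpha> by (intro power_mono) auto
        then have "\<alpha> a ^ (2 * n) \<le> M ^ (2 * n)"
          by (simp add: power_even_abs)
        then show "\<alpha> (a ^ (2 * n)) \<le> \<alpha> (of_real (M ^ (2 * n)))"
          using \<alpha> S by (simp add: character_power character_of_real subset_iff del: of_real_power)
      qed
      then show "L (a ^ (2 * n)) \<le> M ^ (2 * n)" for n
        by (simp only: L_real)
    qed
  qed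
  then show "\<forall>a. C_finite L a" by blast
  define C where "C a = real_of_ereal (C_bound L a)" for a
  have C_nonneg: "0 \<le> C a" and C_power: "n \<ge> 1 \<Longrightarrow> L (a ^ (2 * n)) \<le> C a ^ (2 * n)" for a n
    using C_finite_bounds[OF finite[of a]] by (simp_all add: C_def)
  have bound: "\<bar>\<alpha> a\<bar> \<le> C a" if \<alpha>: "\<alpha> \<in> S" for \<alpha> a
  proof (rule ccontr)
    assume "\<not> \<bar>\<alpha> a\<bar> \<le> C a"
    then obtain t where t: "C a < t" "t < \<bar>\<alpha> a\<bar>"
      using dense by (metis not_le)
    define U where "U = {\<beta> \<in> characters. \<beta> a \<in> {x. t < \<bar>x\<bar>}}"
    have U: "openin char_space U"
      unfolding U_def by (intro openin_evaluation_preimage open_Collect_less continuous_intros)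
    moreover have "\<alpha> \<in> U"
      using t \<alpha> S by (auto simp: U_def)
    ultimately have pos: "0 < measure \<mu> U"
      using \<alpha> by (auto simp: S_def measure_support_def emeasure_eq_measure)
    have UM: "U \<in> sets \<mu>"
      using U r by (auto simp: radon_measure_on_def)
    have le: "measure \<mu> U \<le> ((C a / t)\<^sup>2) ^ n" if "n \<ge> 1" for n
    proof -
      have "t ^ (2 * n) * measure \<mu> U = (\<integral>\<beta>. t ^ (2 * n) * indicator U \<beta> \<partial>\<mu>)"
        using UM by simp
      also have "\<dots> \<le> (\<integral>\<beta>. \<beta> (a ^ (2 * n)) \<partial>\<mu>)"
      proof (rule integral_mono_AE[OF _ int])
        show "AE \<beta> in \<mu>. t ^ (2 * n) * indicator U \<beta> \<le> \<beta> (a ^ (2 * n))"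
          using AE_S
        proof eventually_elim
          case (elim \<beta>)
          have "t ^ (2 * n) \<le> \<bar>\<beta> a\<bar> ^ (2 * n)" if "\<beta> \<in> U"
            using that t C_nonneg[of a] by (intro power_mono) (auto simp: U_def)
          then show ?case
            using elim S by (auto simp: indicator_def character_power power_even_abs subset_iff)
        qed
        show "integrable \<mu> (\<lambda>\<beta>. t ^ (2 * n) * indicator U \<beta>)"
          using UM by (intro integrable_mult_right integrable_real_indicator) (auto simp: emeasure_eq_measure)
      qed
      also have "\<dots> \<le> C a ^ (2 * n)"
        using C_power[OF that, of a] by (simp add: L_eq)
      finally have "t ^ (2 * n) * measure \<mu> U \<le> C a ^ (2 * n)" .
      moreover have "0 < t ^ (2 * n)"
        using t C_nonneg[of a] by simp
      ultimately have "measure \<mu> U \<le> C a ^ (2 * n) / t ^ (2 * n)"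
        by (simp only: pos_le_divide_eq mult.commute)
      then show ?thesis
        by (simp only: power_divide flip: power_mult)
    qed
    have "(C a / t)\<^sup>2 < 1"
      using t C_nonneg[of a] by (intro power_less_one_iff[THEN iffD2]) (auto simp: field_simps)
    then obtain n where n: "((C a / t)\<^sup>2) ^ n < measure \<mu> U"
      using real_arch_pow_inv[OF pos] by blast
    \<comment> \<open>the power \<open>Suc n\<close> because the moment bound requires a positive exponent\<close>
    have "((C a / t)\<^sup>2) ^ Suc n \<le> ((C a / t)\<^sup>2) ^ n"
      using \<open>(C a / t)\<^sup>2 < 1\<close> by (intro power_decreasing) auto
    with n le[of "Suc n"] show False by simp
  qed
  show "nonneg_on_products L (\<lambda>a. real_of_ereal (C_bound L a))"
    unfolding nonneg_on_products_def C_def[symmetric]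
  proof (intro allI impI)
    fix n :: nat and a :: "nat \<Rightarrow> 'a" and j :: "nat \<Rightarrow> nat"
    show "0 \<le> L (\<Prod>i=1..n. signed_factor C (j i) (a i))"
    proof (rule L_nonneg)
      fix \<alpha> assume \<alpha>: "\<alpha> \<in> S"
      then have "\<alpha> \<in> characters" using S by blast
      moreover have "0 \<le> \<alpha> (signed_factor C (j i) (a i))" for i
        using bound[OF \<alpha>, of "a i"] \<open>\<alpha> \<in> characters\<close>
        by (auto simp: signed_factor_def linear_add linear_diff character_linear character_of_real abs_le_iff)
      ultimately show "0 \<le> \<alpha> (\<Prod>i=1..n. signed_factor C (j i) (a i))"
        by (simp add: character_prod prod_nonneg)
    qed
  qed
qed

section \<open>Characterisation of functionals with a representing measure\<close>

text \<open>
  On the box of \<open>T\<close> the elements \<open>a\<^bsup>2n\<^esup>\<close> and \<open>T\<^sub>a\<^bsup>2n\<^esup> - a\<^bsup>2n\<^esup>\<close> are nonnegative.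
\<close>

theorem C_bound_le_of_nonneg_on_products:
  assumes L: "linear L" "L 1 = 1" "nonneg_on_products L T" and T: "\<And>a. 0 < T a"
  shows "positive_semidefinite L" "C_finite L a" "C_bound L a \<le> ereal (T a)"
proof -
  have even_nonneg: "0 \<le> L (b ^ (2 * n))" for b n
    by (rule nonneg_on_box_imp_nonneg[OF L]) (simp add: character_box_def character_power)
  then show "positive_semidefinite L"
    unfolding positive_semidefinite_def by (metis mult_1_right)
  have "L (a ^ (2 * n)) \<le> T a ^ (2 * n)" for n
  proof -
    have "0 \<le> L (of_real (T a ^ (2 * n)) - a ^ (2 * n))"
    proof (rule nonneg_on_box_imp_nonneg[OF L])
      fix \<alpha> assume \<alpha>: "\<alpha> \<in> character_box T"
      then have "\<bar>\<alpha> a\<bar> ^ (2 * n) \<le> T a ^ (2 * n)"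
        by (intro power_mono) (auto simp: character_box_def)
      then show "0 \<le> \<alpha> (of_real (T a ^ (2 * n)) - a ^ (2 * n))"
        using \<alpha> by (simp add: character_box_def linear_diff character_linear character_power character_of_real
            power_even_abs del: of_real_power)
    qed
    moreover have "L (of_real (T a ^ (2 * n))) = T a ^ (2 * n)"
      using L by (simp add: of_real_def linear_scale)
    ultimately show ?thesis
      using L by (simp add: linear_diff del: of_real_power)
  qed
  then show "C_finite L a" "C_bound L a \<le> ereal (T a)"
    using C_finiteI[of "T a" L a] T[of a] even_nonneg by (simp_all add: less_imp_le)
qed

theorem theorem2p5:
  fixes L :: "'a::{real_algebra_1,comm_ring_1} \<Rightarrow> real"
  assumes "(characters :: ('a \<Rightarrow> real) set) \<noteq> {}"
    and "linear L"
    and "L 1 = 1"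
  shows "((\<exists>!\<nu>. representing_measure L \<nu> \<and> compactin char_space (measure_support char_space \<nu>))
            \<longleftrightarrow> (\<forall>a. C_finite L a) \<and>
                nonneg_on_products L (\<lambda>a. real_of_ereal (C_bound L a)))
         \<and> (\<forall>T :: 'a \<Rightarrow> real. (\<forall>a. T a > 0) \<and> nonneg_on_products L T \<longrightarrow>
              positive_semidefinite L \<and> (\<forall>a. C_finite L a) \<and>
              (\<forall>a. C_bound L a \<le> ereal (T a)))"
proof (intro conjI iffI allI impI)
  assume "\<exists>!\<nu>. representing_measure L \<nu> \<and> compactin char_space (measure_support char_space \<nu>)"
  then obtain \<nu> where "representing_measure L \<nu>" "compactin char_space (measure_support char_space \<nu>)"
    by blast
  from representing_measure_necessary[OF this assms(3)]
  show "C_finite L a" "nonneg_on_products L (\<lambda>a. real_of_ereal (C_bound L a))" for a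
    by auto
next
  define c where "c = (\<lambda>a. real_of_ereal (C_bound L a))"
  assume "(\<forall>a. C_finite L a) \<and> nonneg_on_products L (\<lambda>a. real_of_ereal (C_bound L a))"
  then have "nonneg_on_products L c"
    by (simp add: c_def)
  then obtain \<nu> where \<nu>: "representing_measure L \<nu>" "emeasure \<nu> (characters - character_box c) = 0"
    using representing_measure_on_box assms by blast
  have "measure_support char_space \<nu> \<subseteq> character_box c"
    using \<nu> compactin_imp_closedin[OF Hausdorff_char_space compactin_character_box]
    by (intro measure_support_subset) auto
  then have "compactin char_space (measure_support char_space \<nu>)"
    using closed_compactin[OF compactin_character_box _ closedin_measure_support] by blast
  then show "\<exists>!\<nu>. representing_measure L \<nu> \<and> compactin char_space (measure_support char_space \<nu>)"
    using \<nu>(1) representing_measure_unique assms(3) by blast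
next
  fix T :: "'a \<Rightarrow> real" and a
  assume "(\<forall>a. 0 < T a) \<and> nonneg_on_products L T"
  then show "positive_semidefinite L" "C_finite L a" "C_bound L a \<le> ereal (T a)"
    using C_bound_le_of_nonneg_on_products[of L T] assms by auto
qed

end
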